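(* Let $A\in B(H,H_o)$ be a frame generator for the unitary representation $(G,\pi,H)$ of a discrete group $G$. (i) If $M\in B(H_G)$ satisfies $M=MP_A$ and $M^*M|_{P_AH_G}$ is invertible in $B(P_AH_G)$, then $L_e^*M\theta_A$ is a frame generator for $(G,\pi,H)$ if and only if $M\in\mathscr R(G)\otimes B(H_o)$. (ii) The collection $\mathscr F_G$ of all the operator frame generators for $(G,\pi,H)$ with range in $H_o$ is uniquely parametrized (i.e., $M\mapsto L_e^*M\theta_A$ is one-to-one on the indicated set of operators $M$) as $$\mathscr F_G=\{L_e^*M\theta_A\mid M\in\mathscr R(G)\otimes B(H_o),\ M=MP_A,\ M^*M|_{P_AH_G}\text{ is invertible in }B(P_AH_G)\}.$$ (iii) If $A$ is Parseval, the collection of all the Parseval operator frame generators for $(G,\pi,H)$ with range in $H_o$ is uniquely parametrized as $$\{L_e^*V\theta_A\mid V\in\mathscr R(G)\otimes B(H_o),\ V^*V=P_A\}.$$ If $B=L_e^*V\theta_A$ with $V\in\mathscr R(G)\otimes B(H_o)$ and $V^*V=P_A$, then $V=\theta_B\theta_A^*$. (iv) If $A$ is Parseval and $P$ is a projection with $P\sim P_A$ in $\mathscr R(G)\otimes B(H_o)$ (Murray-von Neumann equivalence), then $P=P_B$ for $B=L_e^*V\theta_A$, where $V\in\mathscr R(G)\otimes B(H_o)$ with $V^*V=P_A$ and $VV^*=P$.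
   Context: $G$ is a discrete group with identity $e$; $H,H_o$ are Hilbert spaces; $H_G:=\ell^2(G)\otimes H_o$; $\{\chi_g\}_{g\in G}$ is the standard basis of $\ell^2(G)$. $\mathscr R(G)\subset B(\ell^2(G))$ is the von Neumann algebra generated by the right regular representation, and $\mathscr R(G)\otimes B(H_o)\subset B(H_G)$ is the von Neumann algebra tensor product. For $g\in G$, $L_g:H_o\to H_G$ is $L_gh=\chi_g\otimes h$. A family $\{A_g\}_{g\in G}\subset B(H,H_o)$ is an operator-valued frame if $\sum_gA_g^*A_g$ converges strongly (net of finite partial sums) to a bounded positive invertible operator; it is Parseval if this operator is $I$. $A\in B(H,H_o)$ is a (Parseval) frame generator for $(G,\pi,H)$, with range in $H_o$, if $\{A\pi_{g^{-1}}\}_{g\in G}$ is a (Parseval) operator-valued frame. For such $A$: $S_A:=\sum_g\pi_gA^*A\pi_{g^{-1}}$, the analysis operator is $\theta_A:=\sum_gL_gA\pi_{g^{-1}}\in B(H,H_G)$ (strong convergence), and the frame projection $P_A:=\theta_AS_A^{-1}\theta_A^*$ is the range projection of $\theta_A$.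
   Formalization: In (i), "L_e^*Mθ_A is a frame generator" is replaced by "B=L_e^*Mθ_A is a frame generator and L_g^*Mθ_A=Bπ_{g^{-1}} for all g"; the literal "only if" fails (G=Z_2, π left regular on ℓ²(G), H_o=ℂ, A=L_e^*, M=diag(1,2)). *)

theory Defs
  imports "HOL-Analysis.Analysis"
begin

section \<open>Complex Hilbert spaces\<close>

text \<open>The norm and the topology come from the underlying real inner product space; the
  complex inner product is antilinear in its first argument.\<close>

class complex_hilbert = real_inner + complete_space +
  fixes scaleC :: "complex \<Rightarrow> 'a \<Rightarrow> 'a"  (infixr "*\<^sub>C" 75)
    and cinner :: "'a \<Rightarrow> 'a \<Rightarrow> complex"
  assumes scaleC_add_right: "c *\<^sub>C (x + y) = c *\<^sub>C x + c *\<^sub>C y"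
    and scaleC_add_left: "(c + d) *\<^sub>C x = c *\<^sub>C x + d *\<^sub>C x"
    and scaleC_scaleC: "c *\<^sub>C d *\<^sub>C x = (c * d) *\<^sub>C x"
    and scaleR_scaleC: "scaleR r x = complex_of_real r *\<^sub>C x"
    and cinner_commute: "cinner x y = cnj (cinner y x)"
    and cinner_add_right: "cinner x (y + z) = cinner x y + cinner x z"
    and cinner_scaleC_right: "cinner x (c *\<^sub>C y) = c * cinner x y"
    and inner_eq_Re_cinner: "inner x y = Re (cinner x y)"

instantiation complex :: complex_hilbert
begin

definition scaleC_complex :: "complex \<Rightarrow> complex \<Rightarrow> complex" where
  "scaleC_complex c x = c * x"

definition cinner_complex :: "complex \<Rightarrow> complex \<Rightarrow> complex" where
  "cinner_complex x y = cnj x * y"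

instance
  by standard
    (auto simp: scaleC_complex_def cinner_complex_def inner_complex_def algebra_simps
      scaleR_conv_of_real)

end

lemma scaleC_one [simp]: "1 *\<^sub>C (x :: 'a :: complex_hilbert) = x"
  by (metis scaleR_scaleC scaleR_one of_real_1)

lemma cinner_add_left:
  "cinner (x + y) z = cinner x z + cinner y (z :: 'a :: complex_hilbert)"
  by (metis cinner_add_right cinner_commute complex_cnj_add)

lemma cinner_scaleC_left: "cinner (c *\<^sub>C x) (y :: 'a :: complex_hilbert) = cnj c * cinner x y"
  by (metis cinner_commute cinner_scaleC_right complex_cnj_mult)

lemma Im_cinner: "Im (cinner x y) = inner (\<i> *\<^sub>C x) (y :: 'a :: complex_hilbert)"
  by (simp add: inner_eq_Re_cinner cinner_scaleC_left)

lemma cinner_eq_inner: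
  "cinner x y = Complex (inner x y) (inner (\<i> *\<^sub>C x) (y :: 'a :: complex_hilbert))"
  by (simp add: complex_eq_iff inner_eq_Re_cinner[symmetric] Im_cinner)

lemma cinner_self: "cinner x x = complex_of_real ((norm (x :: 'a :: complex_hilbert))\<^sup>2)"
proof -
  have "cnj (cinner x x) = cinner x x"
    by (metis cinner_commute)
  then have "Im (cinner x x) = 0"
    by (simp add: complex_eq_iff)
  then show ?thesis
    by (simp add: complex_eq_iff inner_eq_Re_cinner[symmetric] power2_norm_eq_inner)
qed

lemma norm_scaleC: "norm (c *\<^sub>C (x :: 'a :: complex_hilbert)) = cmod c * norm x"
proof -
  have "complex_of_real ((norm (c *\<^sub>C x))\<^sup>2) = (c * cnj c) * cinner x x"
    unfolding cinner_self[symmetric]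
    by (simp add: cinner_scaleC_left cinner_scaleC_right mult.assoc)
  also have "\<dots> = complex_of_real ((cmod c * norm x)\<^sup>2)"
    by (simp add: complex_norm_square[symmetric] cinner_self power_mult_distrib)
  finally have "complex_of_real ((norm (c *\<^sub>C x))\<^sup>2) = complex_of_real ((cmod c * norm x)\<^sup>2)" .
  then have "(norm (c *\<^sub>C x))\<^sup>2 = (cmod c * norm x)\<^sup>2"
    using of_real_eq_iff by blast
  then show ?thesis
    by (simp add: power2_eq_iff_nonneg)
qed


section \<open>The Hilbert space of square-summable families\<close>

text \<open>\<open>('g, 'h) ell2\<close> is the space of square-summable functions from \<open>'g\<close> to \<open>'h\<close>.
  So \<open>('g, complex) ell2\<close> is the usual space of square-summable functions on \<open>'g\<close>, and
  \<open>('g, 'h) ell2\<close> is its Hilbert space tensor product with \<open>'h\<close>: see \<open>tensor\<close> below.\<close>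

typedef (overloaded) ('g, 'h :: real_normed_vector) ell2 =
  "{f :: 'g \<Rightarrow> 'h. (\<lambda>g. (norm (f g))\<^sup>2) summable_on UNIV}"
  morphisms coord Abs_ell2
  by (rule exI[of _ "\<lambda>_. 0"]) simp

setup_lifting type_definition_ell2

lemma coord_summable: "(\<lambda>g. (norm (coord f g))\<^sup>2) summable_on UNIV"
  using coord[of f] by simp

lemma ell2_eqI: "(\<And>g. coord f g = coord f' g) \<Longrightarrow> f = f'"
  by (simp add: coord_inject[symmetric] fun_eq_iff)

lemma square_summable_add:
  fixes f f' :: "'g \<Rightarrow> 'h :: real_normed_vector"
  assumes "(\<lambda>g. (norm (f g))\<^sup>2) summable_on UNIV" "(\<lambda>g. (norm (f' g))\<^sup>2) summable_on UNIV"
  shows "(\<lambda>g. (norm (f g + f' g))\<^sup>2) summable_on UNIV"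
proof (rule summable_on_comparison_test)
  show "(\<lambda>g. 2 * ((norm (f g))\<^sup>2 + (norm (f' g))\<^sup>2)) summable_on UNIV"
    by (intro summable_on_cmult_right summable_on_add assms)
  fix g
  have "(norm (f g + f' g))\<^sup>2 \<le> (norm (f g) + norm (f' g))\<^sup>2"
    by (intro power_mono norm_triangle_ineq) auto
  also have "\<dots> \<le> 2 * ((norm (f g))\<^sup>2 + (norm (f' g))\<^sup>2)"
    using sum_squares_bound[of "norm (f g)" "norm (f' g)"] by (simp add: power2_sum)
  finally show "(norm (f g + f' g))\<^sup>2 \<le> 2 * ((norm (f g))\<^sup>2 + (norm (f' g))\<^sup>2)" .
qed auto

lemma square_summable_bound:
  fixes f :: "'g \<Rightarrow> 'h :: real_normed_vector" and f' :: "'g \<Rightarrow> 'k :: real_normed_vector"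
  assumes "(\<lambda>g. (norm (f g))\<^sup>2) summable_on UNIV" "\<And>g. norm (f' g) \<le> c * norm (f g)"
  shows "(\<lambda>g. (norm (f' g))\<^sup>2) summable_on UNIV"
proof (rule summable_on_comparison_test)
  show "(\<lambda>g. c\<^sup>2 * (norm (f g))\<^sup>2) summable_on UNIV"
    by (intro summable_on_cmult_right assms)
  show "(norm (f' g))\<^sup>2 \<le> c\<^sup>2 * (norm (f g))\<^sup>2" for g
    using power_mono[OF assms(2)[of g], of 2] by (simp add: power_mult_distrib)
qed auto

instantiation ell2 :: (type, real_normed_vector) real_vector
begin

lift_definition zero_ell2 :: "('a, 'b) ell2" is "\<lambda>_. 0" by simp

lift_definition plus_ell2 :: "('a, 'b) ell2 \<Rightarrow> ('a, 'b) ell2 \<Rightarrow> ('a, 'b) ell2" is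
  "\<lambda>f f' g. f g + f' g" by (rule square_summable_add)

lift_definition uminus_ell2 :: "('a, 'b) ell2 \<Rightarrow> ('a, 'b) ell2" is
  "\<lambda>f g. - f g" by simp

lift_definition scaleR_ell2 :: "real \<Rightarrow> ('a, 'b) ell2 \<Rightarrow> ('a, 'b) ell2" is
  "\<lambda>r f g. r *\<^sub>R f g" by (rule square_summable_bound[OF _ norm_scaleR[THEN eq_refl]])

definition minus_ell2 :: "('a, 'b) ell2 \<Rightarrow> ('a, 'b) ell2 \<Rightarrow> ('a, 'b) ell2" where
  "minus_ell2 f f' = f + - f'"

instance
proof
  fix x y z :: "('a, 'b) ell2" and r s :: real
  note rep_eq = zero_ell2.rep_eq plus_ell2.rep_eq uminus_ell2.rep_eq scaleR_ell2.rep_eq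
  show "x - y = x + - y"
    by (rule minus_ell2_def)
  show "x + y + z = x + (y + z)" "x + y = y + x" "0 + x = x" "- x + x = 0"
    by (rule ell2_eqI; simp add: rep_eq add.assoc add.commute)+
  show "r *\<^sub>R (x + y) = r *\<^sub>R x + r *\<^sub>R y" "(r + s) *\<^sub>R x = r *\<^sub>R x + s *\<^sub>R x"
    "r *\<^sub>R s *\<^sub>R x = (r * s) *\<^sub>R x" "1 *\<^sub>R x = x"
    by (rule ell2_eqI; simp add: rep_eq scaleR_add_right scaleR_add_left)+
qed

end

lemma coord_simps [simp]:
  "coord 0 g = 0" "coord (f + f') g = coord f g + coord f' g"
  "coord (- f) g = - coord f g" "coord (r *\<^sub>R f) g = r *\<^sub>R coord f g"
  "coord (f - f') g = coord f g - coord f' g"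
  unfolding minus_ell2_def zero_ell2.rep_eq plus_ell2.rep_eq uminus_ell2.rep_eq
    scaleR_ell2.rep_eq by simp_all

lemma inner_summable:
  fixes f f' :: "('g, 'h :: real_inner) ell2"
  shows "(\<lambda>g. inner (coord f g) (coord f' g)) summable_on UNIV"
proof -
  have "(\<lambda>g. norm (inner (coord f g) (coord f' g))) summable_on UNIV"
  proof (rule summable_on_comparison_test)
    show "(\<lambda>g. (norm (coord f g))\<^sup>2 + (norm (coord f' g))\<^sup>2) summable_on UNIV"
      by (intro summable_on_add coord_summable)
    fix g
    have "\<bar>inner (coord f g) (coord f' g)\<bar> \<le> norm (coord f g) * norm (coord f' g)"
      by (rule Cauchy_Schwarz_ineq2)
    also have "\<dots> \<le> (norm (coord f g))\<^sup>2 + (norm (coord f' g))\<^sup>2"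
    proof -
      have "0 \<le> norm (coord f g) * norm (coord f' g)"
        by simp
      then show ?thesis
        using sum_squares_bound[of "norm (coord f g)" "norm (coord f' g)"] by linarith
    qed
    finally show "norm (inner (coord f g) (coord f' g))
      \<le> (norm (coord f g))\<^sup>2 + (norm (coord f' g))\<^sup>2" by simp
  qed auto
  then show ?thesis
    by (rule abs_summable_summable)
qed

instantiation ell2 :: (type, real_inner) real_inner
begin

definition inner_ell2 :: "('a, 'b) ell2 \<Rightarrow> ('a, 'b) ell2 \<Rightarrow> real" where
  "inner_ell2 f f' = (\<Sum>\<^sub>\<infinity>g. inner (coord f g) (coord f' g))"

definition norm_ell2 :: "('a, 'b) ell2 \<Rightarrow> real" where
  "norm_ell2 f = sqrt (inner f f)"

definition sgn_ell2 :: "('a, 'b) ell2 \<Rightarrow> ('a, 'b) ell2" where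
  "sgn_ell2 f = inverse (norm f) *\<^sub>R f"

definition dist_ell2 :: "('a, 'b) ell2 \<Rightarrow> ('a, 'b) ell2 \<Rightarrow> real" where
  "dist_ell2 f f' = norm (f - f')"

definition uniformity_ell2 :: "(('a, 'b) ell2 \<times> ('a, 'b) ell2) filter" where
  "uniformity_ell2 = (INF e\<in>{0<..}. principal {(f, f'). dist f f' < e})"

definition open_ell2 :: "('a, 'b) ell2 set \<Rightarrow> bool" where
  "open_ell2 U \<longleftrightarrow> (\<forall>x\<in>U. eventually (\<lambda>(x', y). x' = x \<longrightarrow> y \<in> U) uniformity)"

instance
proof
  fix x y z :: "('a, 'b) ell2" and r :: real
  show "inner x y = inner y x"
    by (simp add: inner_ell2_def inner_commute)
  show "inner (x + y) z = inner x z + inner y z"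
    by (simp add: inner_ell2_def inner_add_left infsum_add inner_summable)
  show "inner (r *\<^sub>R x) y = r * inner x y"
    by (simp add: inner_ell2_def infsum_cmult_right')
  show "0 \<le> inner x x"
    by (auto simp: inner_ell2_def intro: infsum_nonneg)
  show "inner x x = 0 \<longleftrightarrow> x = 0"
  proof
    assume 0: "inner x x = 0"
    have "inner (coord x g) (coord x g) = 0" for g
      by (rule nonneg_infsum_le_0D[where A = UNIV])
        (use 0 inner_summable[of x x] in \<open>auto simp: inner_ell2_def\<close>)
    then show "x = 0"
      by (auto intro: ell2_eqI)
  qed (simp add: inner_ell2_def)
qed (simp_all add: norm_ell2_def sgn_ell2_def dist_ell2_def uniformity_ell2_def open_ell2_def)

end

lemma norm_ell2_square:
  fixes f :: "('g, 'h :: real_inner) ell2"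
  shows "(norm f)\<^sup>2 = (\<Sum>\<^sub>\<infinity>g. (norm (coord f g))\<^sup>2)"
  by (simp add: power2_norm_eq_inner inner_ell2_def)

lemma sum_coord_le:
  fixes f :: "('g, 'h :: real_inner) ell2"
  assumes "finite F"
  shows "(\<Sum>g\<in>F. (norm (coord f g))\<^sup>2) \<le> (norm f)\<^sup>2"
  unfolding norm_ell2_square
  by (rule finite_sum_le_infsum) (use assms coord_summable in auto)

lemma norm_coord_le:
  fixes f :: "('g, 'h :: real_inner) ell2"
  shows "norm (coord f g) \<le> norm f"
  using sum_coord_le[of "{g}" f] by (intro power2_le_imp_le[OF _ norm_ge_zero]) simp

instance ell2 :: (type, "{real_inner, complete_space}") complete_space
proof
  fix X :: "nat \<Rightarrow> ('a, 'b) ell2"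
  assume X: "Cauchy X"
  have "Cauchy (\<lambda>n. coord (X n) g)" for g
    unfolding Cauchy_altdef2
  proof (intro allI impI)
    fix e :: real assume "e > 0"
    then obtain N where N: "\<forall>n\<ge>N. dist (X n) (X N) < e"
      using X unfolding Cauchy_altdef2 by blast
    have "dist (coord (X n) g) (coord (X N) g) \<le> dist (X n) (X N)" for n
      using norm_coord_le[of "X n - X N" g] by (simp add: dist_norm)
    then show "\<exists>N. \<forall>n\<ge>N. dist (coord (X n) g) (coord (X N) g) < e"
      using N by (meson order.strict_trans1)
  qed
  then have "\<forall>g. \<exists>l. (\<lambda>n. coord (X n) g) \<longlonglongrightarrow> l"
    using Cauchy_convergent_iff convergent_def by blast
  then obtain l where l: "\<And>g. (\<lambda>n. coord (X n) g) \<longlonglongrightarrow> l g"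
    by metis
  have bound: "(\<Sum>g\<in>F. (norm (coord (X n) g - l g))\<^sup>2) \<le> e\<^sup>2"
    if N: "\<And>m. m \<ge> N \<Longrightarrow> dist (X n) (X m) \<le> e" and F: "finite F" for F N e n
  proof (rule LIMSEQ_le_const2)
    show "(\<lambda>m. \<Sum>g\<in>F. (norm (coord (X n) g - coord (X m) g))\<^sup>2)
        \<longlonglongrightarrow> (\<Sum>g\<in>F. (norm (coord (X n) g - l g))\<^sup>2)"
      by (intro tendsto_intros l)
    show "\<exists>M. \<forall>m\<ge>M. (\<Sum>g\<in>F. (norm (coord (X n) g - coord (X m) g))\<^sup>2) \<le> e\<^sup>2"
    proof (intro exI[of _ N] allI impI)
      fix m assume "m \<ge> N"
      have "(\<Sum>g\<in>F. (norm (coord (X n) g - coord (X m) g))\<^sup>2) \<le> (norm (X n - X m))\<^sup>2"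
        using sum_coord_le[OF F, of "X n - X m"] by simp
      also have "\<dots> \<le> e\<^sup>2"
        using N[OF \<open>m \<ge> N\<close>] by (intro power_mono) (auto simp: dist_norm)
      finally show "(\<Sum>g\<in>F. (norm (coord (X n) g - coord (X m) g))\<^sup>2) \<le> e\<^sup>2" .
    qed
  qed
  have sq: "(\<lambda>g. (norm (coord (X n) g - l g))\<^sup>2) summable_on UNIV"
    if N: "\<And>m. m \<ge> N \<Longrightarrow> dist (X n) (X m) \<le> e" for N e n
  proof (rule nonneg_bdd_above_summable_on)
    show "bdd_above (sum (\<lambda>g. (norm (coord (X n) g - l g))\<^sup>2) ` {F. F \<subseteq> UNIV \<and> finite F})"
      using bound[OF N] by (intro bdd_aboveI[of _ "e\<^sup>2"]) blast
  qed simp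
  obtain N0 where N0: "\<And>m n. m \<ge> N0 \<Longrightarrow> n \<ge> N0 \<Longrightarrow> dist (X m) (X n) < 1"
    using X zero_less_one unfolding Cauchy_def by blast
  have "(\<lambda>g. (norm (coord (X N0) g + - (coord (X N0) g - l g)))\<^sup>2) summable_on UNIV"
  proof (rule square_summable_add)
    show "(\<lambda>g. (norm (- (coord (X N0) g - l g)))\<^sup>2) summable_on UNIV"
      using sq[of N0 N0 1] N0 by (auto simp: less_imp_le norm_minus_commute)
  qed (rule coord_summable)
  then have "(\<lambda>g. (norm (l g))\<^sup>2) summable_on UNIV"
    by simp
  then have L: "coord (Abs_ell2 l) = l"
    by (simp add: Abs_ell2_inverse)
  have "X \<longlonglongrightarrow> Abs_ell2 l"
    unfolding lim_sequentially
  proof (intro allI impI)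
    fix e :: real assume e: "e > 0"
    then obtain N where N: "\<And>m n. m \<ge> N \<Longrightarrow> n \<ge> N \<Longrightarrow> dist (X m) (X n) < e / 2"
      using X unfolding Cauchy_def by (meson half_gt_zero)
    show "\<exists>N. \<forall>n\<ge>N. dist (X n) (Abs_ell2 l) < e"
    proof (intro exI[of _ N] allI impI)
      fix n assume n: "n \<ge> N"
      have le: "\<And>m. m \<ge> N \<Longrightarrow> dist (X n) (X m) \<le> e / 2"
        using N n by (auto intro: less_imp_le)
      have "(norm (X n - Abs_ell2 l))\<^sup>2 = (\<Sum>\<^sub>\<infinity>g. (norm (coord (X n) g - l g))\<^sup>2)"
        by (simp add: norm_ell2_square L)
      also have "\<dots> \<le> (e / 2)\<^sup>2"
      proof (rule infsum_le_finite_sums)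
        show "(\<lambda>g. (norm (coord (X n) g - l g))\<^sup>2) summable_on UNIV"
          using le by (rule sq)
        show "(\<Sum>g\<in>F. (norm (coord (X n) g - l g))\<^sup>2) \<le> (e / 2)\<^sup>2" if "finite F" for F
          using le that by (rule bound)
      qed
      finally have "norm (X n - Abs_ell2 l) \<le> e / 2"
        by (rule power2_le_imp_le) (use e in simp)
      then show "dist (X n) (Abs_ell2 l) < e"
        using e by (simp add: dist_norm)
    qed
  qed
  then show "convergent X"
    by (auto simp: convergent_def)
qed

lemma cinner_summable:
  fixes f f' :: "('g, 'h :: complex_hilbert) ell2"
  shows "(\<lambda>g. cinner (coord f g) (coord f' g)) summable_on UNIV"
proof -
  have sq: "(\<lambda>g. (norm (\<i> *\<^sub>C coord f g))\<^sup>2) summable_on UNIV"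
    using coord_summable[of f] by (simp add: norm_scaleC)
  have 1: "(\<lambda>g. inner (coord f g) (coord f' g)) summable_on UNIV"
    by (rule inner_summable)
  have 2: "(\<lambda>g. inner (\<i> *\<^sub>C coord f g) (coord f' g)) summable_on UNIV"
    using inner_summable[of "Abs_ell2 (\<lambda>g. \<i> *\<^sub>C coord f g)" f'] sq
    by (simp add: Abs_ell2_inverse)
  have "(\<lambda>g. complex_of_real (inner (coord f g) (coord f' g))
      + \<i> * complex_of_real (inner (\<i> *\<^sub>C coord f g) (coord f' g))) summable_on UNIV"
    by (intro summable_on_add summable_on_cmult_right summable_on_of_real 1 2)
  then show ?thesis
    by (simp add: cinner_eq_inner Complex_eq)
qed

instantiation ell2 :: (type, complex_hilbert) complex_hilbert
begin

lift_definition scaleC_ell2 :: "complex \<Rightarrow> ('a, 'b) ell2 \<Rightarrow> ('a, 'b) ell2" is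
  "\<lambda>c f g. c *\<^sub>C f g" by (rule square_summable_bound[OF _ norm_scaleC[THEN eq_refl]])

definition cinner_ell2 :: "('a, 'b) ell2 \<Rightarrow> ('a, 'b) ell2 \<Rightarrow> complex" where
  "cinner_ell2 f f' = (\<Sum>\<^sub>\<infinity>g. cinner (coord f g) (coord f' g))"

instance
proof
  fix x y z :: "('a, 'b) ell2" and c d :: complex and r :: real
  show "c *\<^sub>C (x + y) = c *\<^sub>C x + c *\<^sub>C y" "(c + d) *\<^sub>C x = c *\<^sub>C x + d *\<^sub>C x"
    "c *\<^sub>C d *\<^sub>C x = (c * d) *\<^sub>C x" "r *\<^sub>R x = complex_of_real r *\<^sub>C x"
    by (transfer; simp add: scaleC_add_right scaleC_add_left scaleC_scaleC scaleR_scaleC)+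
  show "cinner x y = cnj (cinner y x)"
    unfolding cinner_ell2_def infsum_cnj[symmetric] by (simp add: cinner_commute[symmetric])
  show "cinner x (y + z) = cinner x y + cinner x z"
    by (simp add: cinner_ell2_def cinner_add_right infsum_add cinner_summable)
  show "cinner x (c *\<^sub>C y) = c * cinner x y"
    by (simp add: cinner_ell2_def scaleC_ell2.rep_eq cinner_scaleC_right infsum_cmult_right')
  show "inner x y = Re (cinner x y)"
    by (simp add: cinner_ell2_def inner_ell2_def infsum_Re[symmetric] cinner_summable
        inner_eq_Re_cinner)
qed

end

lemma coord_scaleC [simp]: "coord (c *\<^sub>C f) g = c *\<^sub>C coord f g"
  by (simp add: scaleC_ell2.rep_eq)


section \<open>The tensor product structure\<close>

lift_definition tensor :: "('g, complex) ell2 \<Rightarrow> 'h \<Rightarrow> ('g, 'h :: complex_hilbert) ell2"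
    (infixr "\<otimes>\<^sub>h" 72)
  is "\<lambda>\<xi> h g. \<xi> g *\<^sub>C h"
proof -
  fix \<xi> :: "'g \<Rightarrow> complex" and h :: 'h
  assume "(\<lambda>g. (norm (\<xi> g))\<^sup>2) summable_on UNIV"
  then show "(\<lambda>g. (norm (\<xi> g *\<^sub>C h))\<^sup>2) summable_on UNIV"
    by (rule square_summable_bound[where c = "norm h"]) (simp add: norm_scaleC)
qed

lift_definition chi :: "'g \<Rightarrow> ('g, complex) ell2" is "\<lambda>g k. if k = g then 1 else 0"
proof -
  fix g :: 'g
  have "(\<lambda>k. (norm (if k = g then 1 else 0 :: complex))\<^sup>2) summable_on {g}"
    by simp
  then show "(\<lambda>k. (norm (if k = g then 1 else 0 :: complex))\<^sup>2) summable_on UNIV"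
    by (rule summable_on_cong_neutral[THEN iffD1, rotated -1]) auto
qed

text \<open>The next two lemmas say that \<open>('g, 'h) ell2\<close> with \<open>tensor\<close> is the Hilbert space tensor
  product of \<open>('g, complex) ell2\<close> and \<open>'h\<close>.\<close>

lemma cinner_tensor: "cinner (\<xi> \<otimes>\<^sub>h h) (\<xi>' \<otimes>\<^sub>h h') = cinner \<xi> \<xi>' * cinner h h'"
  unfolding cinner_ell2_def tensor.rep_eq infsum_cmult_left'[symmetric]
  by (simp add: cinner_scaleC_left cinner_scaleC_right cinner_complex_def ac_simps)

lemma closure_span_tensor:
  "closure (span {\<xi> \<otimes>\<^sub>h h | \<xi> h. True}) = (UNIV :: ('g, 'h :: complex_hilbert) ell2 set)"
proof (intro set_eqI iffI UNIV_I)
  fix f :: "('g, 'h) ell2"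
  show "f \<in> closure (span {\<xi> \<otimes>\<^sub>h h | \<xi> h. True})"
    unfolding closure_approachable
  proof (intro allI impI)
    fix e :: real assume e: "e > 0"
    let ?s = "\<lambda>g. (norm (coord f g))\<^sup>2"
    have "((\<lambda>F. sum ?s F) \<longlongrightarrow> (norm f)\<^sup>2) (finite_subsets_at_top UNIV)"
      using has_sum_infsum[OF coord_summable[of f]]
      by (simp add: has_sum_def norm_ell2_square)
    then have "eventually (\<lambda>F. dist (sum ?s F) ((norm f)\<^sup>2) < e\<^sup>2) (finite_subsets_at_top UNIV)"
      using e by (intro tendstoD) auto
    then obtain F where F: "finite F" "dist (sum ?s F) ((norm f)\<^sup>2) < e\<^sup>2"
      unfolding eventually_finite_subsets_at_top by blast
    define u where "u = (\<Sum>g\<in>F. chi g \<otimes>\<^sub>h coord f g)"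
    have coord_sum: "coord (sum v F) k = (\<Sum>g\<in>F. coord (v g) k)"
      for v :: "'g \<Rightarrow> ('g, 'h) ell2" and k
      using F(1) by (induction F rule: finite_induct) auto
    have zero: "0 *\<^sub>C x = 0" for x :: 'h
      by (metis scaleR_scaleC scaleR_zero_left of_real_0)
    have u: "coord u k = (if k \<in> F then coord f k else 0)" for k
    proof -
      have "coord u k = (\<Sum>g\<in>F. if g = k then coord f g else 0)"
        unfolding u_def coord_sum
        by (rule sum.cong) (auto simp: tensor.rep_eq chi.rep_eq zero)
      then show ?thesis
        using F(1) by simp
    qed
    have "inner u f = (norm u)\<^sup>2"
      unfolding power2_norm_eq_inner inner_ell2_def
      by (rule infsum_cong) (simp add: u)
    moreover have "(norm u)\<^sup>2 = sum ?s F"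
    proof -
      have "(norm u)\<^sup>2 = (\<Sum>\<^sub>\<infinity>g\<in>F. ?s g)"
        unfolding norm_ell2_square by (rule infsum_cong_neutral) (auto simp: u)
      then show ?thesis
        using F(1) by simp
    qed
    ultimately have "(norm (u - f))\<^sup>2 = (norm f)\<^sup>2 - sum ?s F"
      by (simp add: power2_norm_eq_inner inner_diff_left inner_diff_right inner_commute)
    also have "\<dots> < e\<^sup>2"
      using F(2) by (simp add: dist_real_def)
    finally have "norm (u - f) < e"
      by (rule power2_less_imp_less) (use e in simp)
    then have "dist u f < e"
      by (simp add: dist_norm)
    moreover have "u \<in> span {\<xi> \<otimes>\<^sub>h h | \<xi> h. True}"
      unfolding u_def by (intro span_sum span_base) blast
    ultimately show "\<exists>u\<in>span {\<xi> \<otimes>\<^sub>h h | \<xi> h. True}. dist u f < e"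
      by blast
  qed
qed


section \<open>Bounded operators\<close>

definition bounded_clinear :: "('a :: complex_hilbert \<Rightarrow> 'b :: complex_hilbert) \<Rightarrow> bool" where
  "bounded_clinear T \<longleftrightarrow> bounded_linear T \<and> (\<forall>c x. T (c *\<^sub>C x) = c *\<^sub>C T x)"

definition adj :: "('a :: complex_hilbert \<Rightarrow> 'b :: complex_hilbert) \<Rightarrow> 'b \<Rightarrow> 'a" where
  "adj T = (THE S. \<forall>x y. cinner (T x) y = cinner x (S y))"

definition positive_op :: "('a :: complex_hilbert \<Rightarrow> 'a) \<Rightarrow> bool" where
  "positive_op T \<longleftrightarrow> bounded_clinear T \<and>
     (\<forall>x. Im (cinner x (T x)) = 0 \<and> 0 \<le> Re (cinner x (T x)))"

definition projection :: "('a :: complex_hilbert \<Rightarrow> 'a) \<Rightarrow> bool" where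
  "projection P \<longleftrightarrow> bounded_clinear P \<and> P \<circ> P = P \<and> adj P = P"

definition unitary :: "('a :: complex_hilbert \<Rightarrow> 'a) \<Rightarrow> bool" where
  "unitary U \<longleftrightarrow> bounded_clinear U \<and> adj U \<circ> U = id \<and> U \<circ> adj U = id"

text \<open>\<open>bounded_op_on K T\<close>: the restriction of \<open>T\<close> to the subspace \<open>K\<close> is a bounded operator
  of \<open>K\<close> into itself; \<open>invertible_on K T\<close>: this restriction is invertible among the bounded
  operators on \<open>K\<close>.\<close>

definition bounded_op_on :: "'a :: complex_hilbert set \<Rightarrow> ('a \<Rightarrow> 'a) \<Rightarrow> bool" where
  "bounded_op_on K T \<longleftrightarrow> (\<forall>x\<in>K. T x \<in> K) \<and>
     (\<forall>x\<in>K. \<forall>y\<in>K. T (x + y) = T x + T y) \<and> (\<forall>c. \<forall>x\<in>K. T (c *\<^sub>C x) = c *\<^sub>C T x) \<and>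
     (\<exists>C. \<forall>x\<in>K. norm (T x) \<le> C * norm x)"

definition invertible_on :: "'a :: complex_hilbert set \<Rightarrow> ('a \<Rightarrow> 'a) \<Rightarrow> bool" where
  "invertible_on K T \<longleftrightarrow> bounded_op_on K T \<and>
     (\<exists>S. bounded_op_on K S \<and> (\<forall>x\<in>K. S (T x) = x \<and> T (S x) = x))"


section \<open>Von Neumann algebras\<close>

definition commutant :: "('a :: complex_hilbert \<Rightarrow> 'a) set \<Rightarrow> ('a \<Rightarrow> 'a) set" where
  "commutant \<S> = {T. bounded_clinear T \<and> (\<forall>X\<in>\<S>. T \<circ> X = X \<circ> T)}"

definition von_neumann_algebra :: "('a :: complex_hilbert \<Rightarrow> 'a) set \<Rightarrow> bool" where
  "von_neumann_algebra \<N> \<longleftrightarrow> (\<forall>T\<in>\<N>. bounded_clinear T) \<and> (\<forall>T\<in>\<N>. adj T \<in> \<N>) \<and>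
     commutant (commutant \<N>) = \<N>"

definition generated_vna :: "('a :: complex_hilbert \<Rightarrow> 'a) set \<Rightarrow> ('a \<Rightarrow> 'a) set" where
  "generated_vna \<S> = \<Inter>{\<N>. von_neumann_algebra \<N> \<and> \<S> \<subseteq> \<N>}"

text \<open>An operator \<open>X\<close> with \<open>X (\<xi> \<otimes>\<^sub>h h) = T \<xi> \<otimes>\<^sub>h S h\<close> for all \<open>\<xi>\<close> and \<open>h\<close> is the tensor
  product of the operators \<open>T\<close> and \<open>S\<close>.\<close>

definition vna_tensor :: "(('g, complex) ell2 \<Rightarrow> ('g, complex) ell2) set \<Rightarrow>
    ('h :: complex_hilbert \<Rightarrow> 'h) set \<Rightarrow> (('g, 'h) ell2 \<Rightarrow> ('g, 'h) ell2) set" where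
  "vna_tensor \<M> \<N> = generated_vna
     {X. bounded_clinear X \<and> (\<exists>T\<in>\<M>. \<exists>S\<in>\<N>. \<forall>\<xi> h. X (\<xi> \<otimes>\<^sub>h h) = T \<xi> \<otimes>\<^sub>h S h)}"

definition mvn_equivalent ::
    "('a :: complex_hilbert \<Rightarrow> 'a) set \<Rightarrow> ('a \<Rightarrow> 'a) \<Rightarrow> ('a \<Rightarrow> 'a) \<Rightarrow> bool" where
  "mvn_equivalent \<N> P Q \<longleftrightarrow> P \<in> \<N> \<and> projection P \<and> Q \<in> \<N> \<and> projection Q \<and>
     (\<exists>V\<in>\<N>. adj V \<circ> V = P \<and> V \<circ> adj V = Q)"

text \<open>The group is written additively (the class \<open>group_add\<close> is not commutative): its identity
  is \<open>0\<close> and the inverse of \<open>g\<close> is \<open>- g\<close>. So \<open>right_regular g\<close> maps \<open>chi k\<close> to \<open>chi (k - g)\<close>.\<close>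

definition right_regular ::
    "'g :: group_add \<Rightarrow> ('g, complex) ell2 \<Rightarrow> ('g, complex) ell2" where
  "right_regular g \<xi> = Abs_ell2 (\<lambda>k. coord \<xi> (k + g))"

definition right_vna :: "(('g :: group_add, complex) ell2 \<Rightarrow> ('g, complex) ell2) set" where
  "right_vna = generated_vna (range right_regular)"

text \<open>The tensor product of the right von Neumann algebra with all bounded operators.\<close>

definition RB :: "(('g :: group_add, 'h :: complex_hilbert) ell2 \<Rightarrow> ('g, 'h) ell2) set" where
  "RB = vna_tensor right_vna {S. bounded_clinear S}"


section \<open>Operator-valued frames and frame generators\<close>

definition unitary_representation ::
    "('g :: group_add \<Rightarrow> 'a :: complex_hilbert \<Rightarrow> 'a) \<Rightarrow> bool" where
  "unitary_representation \<pi> \<longleftrightarrow> (\<forall>g. unitary (\<pi> g)) \<and> (\<forall>g k. \<pi> (g + k) = \<pi> g \<circ> \<pi> k)"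

definition ov_frame :: "('g \<Rightarrow> 'a :: complex_hilbert \<Rightarrow> 'b :: complex_hilbert) \<Rightarrow> bool" where
  "ov_frame F \<longleftrightarrow> (\<forall>g. bounded_clinear (F g)) \<and>
     (\<exists>S. positive_op S \<and> invertible_on UNIV S \<and>
        (\<forall>x. ((\<lambda>g. adj (F g) (F g x)) has_sum S x) UNIV))"

definition parseval_ov_frame ::
    "('g \<Rightarrow> 'a :: complex_hilbert \<Rightarrow> 'b :: complex_hilbert) \<Rightarrow> bool" where
  "parseval_ov_frame F \<longleftrightarrow> (\<forall>g. bounded_clinear (F g)) \<and>
     (\<forall>x. ((\<lambda>g. adj (F g) (F g x)) has_sum x) UNIV)"

context
  fixes \<pi> :: "'g :: group_add \<Rightarrow> 'a :: complex_hilbert \<Rightarrow> 'a"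
begin

definition frame_generator :: "('a \<Rightarrow> 'b :: complex_hilbert) \<Rightarrow> bool" where
  "frame_generator A \<longleftrightarrow> bounded_clinear A \<and> ov_frame (\<lambda>g. A \<circ> \<pi> (- g))"

definition parseval_frame_generator :: "('a \<Rightarrow> 'b :: complex_hilbert) \<Rightarrow> bool" where
  "parseval_frame_generator A \<longleftrightarrow> bounded_clinear A \<and> parseval_ov_frame (\<lambda>g. A \<circ> \<pi> (- g))"

text \<open>A frame indexed by the group is generated by \<open>B\<close> if it is the orbit family of the frame
  generator \<open>B\<close>. An operator \<open>M\<close> on the tensor product gives the family
  \<open>adj (L g) \<circ> M \<circ> analysis \<pi> A\<close>, of which \<open>adj (L 0) \<circ> M \<circ> analysis \<pi> A\<close> is only the member at
  the identity. That this member is a frame generator does not restrict the other rows of \<open>M\<close>;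
  that it generates the whole family does.\<close>

definition generates_frame ::
    "('a \<Rightarrow> 'b :: complex_hilbert) \<Rightarrow> ('g \<Rightarrow> 'a \<Rightarrow> 'b) \<Rightarrow> bool" where
  "generates_frame B F \<longleftrightarrow> frame_generator B \<and> (\<forall>g. F g = B \<circ> \<pi> (- g))"

definition frame_operator :: "('a \<Rightarrow> 'b :: complex_hilbert) \<Rightarrow> 'a \<Rightarrow> 'a" where
  "frame_operator A x = (\<Sum>\<^sub>\<infinity>g. \<pi> g (adj A (A (\<pi> (- g) x))))"

end

definition L :: "'g \<Rightarrow> 'h :: complex_hilbert \<Rightarrow> ('g, 'h) ell2" where
  "L g h = chi g \<otimes>\<^sub>h h"

definition analysis ::
    "('g :: group_add \<Rightarrow> 'a \<Rightarrow> 'a) \<Rightarrow> ('a :: complex_hilbert \<Rightarrow> 'h :: complex_hilbert) \<Rightarrow>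
     'a \<Rightarrow> ('g, 'h) ell2" where
  "analysis \<pi> A x = (\<Sum>\<^sub>\<infinity>g. L g (A (\<pi> (- g) x)))"

definition frame_projection ::
    "('g :: group_add \<Rightarrow> 'a \<Rightarrow> 'a) \<Rightarrow> ('a :: complex_hilbert \<Rightarrow> 'h :: complex_hilbert) \<Rightarrow>
     ('g, 'h) ell2 \<Rightarrow> ('g, 'h) ell2" where
  "frame_projection \<pi> A = analysis \<pi> A \<circ> inv (frame_operator \<pi> A) \<circ> adj (analysis \<pi> A)"

end

theory Submission
  imports Defs
begin

text \<open>Both \<open>RB\<close>, a generated von Neumann algebra, and the frame generators, defined by
  convergence of infinite sums, are first described by algebraic conditions on bounded operators.

  First, the tensor product \<open>RB\<close> of the right von Neumann algebra with all bounded operators is the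
  commutant of the left translations (\<open>RB_eq_commutant\<close>). One inclusion holds because that
  commutant is a von Neumann algebra containing the elementary tensors. For the other, an operator
  \<open>M\<close> commuting with left translations has to commute with every \<open>Y\<close> that commutes with the right
  translations and with all \<open>1 \<otimes> S\<close>. The matrix of \<open>M\<close> has entries \<open>m (- l + g)\<close>, that of \<open>Y\<close>
  has entries \<open>y (g - l)\<close> commuting with all bounded operators, and the matrix products of \<open>M\<close>
  and \<open>Y\<close> in either order are rearrangements of the same unconditionally convergent sum
  (\<open>translate_commutant_commute\<close>).

  Second, \<open>B\<close> is a frame generator if and only if some bounded operator \<open>\<eta>\<close> has the components
  \<open>B \<circ> \<pi> (- g)\<close> and \<open>adj \<eta> \<circ> \<eta>\<close> is invertible (\<open>frame_generator_iff\<close>); then \<open>\<eta>\<close> is the analysis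
  operator of \<open>B\<close>, and it intertwines \<open>\<pi>\<close> with left translation.

  Let \<open>\<theta>\<close> be the analysis operator of \<open>A\<close>, \<open>T\<close> the inverse of its frame operator and
  \<open>P = \<theta> \<circ> T \<circ> adj \<theta>\<close>. If \<open>M = M \<circ> P\<close>, then \<open>M\<close> commutes with left translations exactly if
  \<open>M \<circ> \<theta>\<close> is the analysis operator of its component at the identity (\<open>RB_iff_analyzes\<close>), and
  \<open>adj M \<circ> M\<close> is invertible on the range of \<open>P\<close> exactly if \<open>adj (M \<circ> \<theta>) \<circ> (M \<circ> \<theta>)\<close> is
  invertible (\<open>invertible_on_range_P_iff\<close>). Thus \<open>M \<mapsto> M \<circ> \<theta>\<close> and
  \<open>\<eta> \<mapsto> \<eta> \<circ> T \<circ> adj \<theta>\<close> are inverse bijections between the operators \<open>M\<close> of the theorem and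
  the analysis operators of frame generators. In the Parseval case \<open>T\<close> is the identity and the
  same bijection matches partial isometries with initial projection \<open>P\<close> and Parseval frame
  generators.\<close>

section \<open>Adjoints of bounded operators\<close>

text \<open>The Riesz representation theorem. The representing vector minimizes
  \<open>(norm x)\<^sup>2 - 2 * f x\<close>; by the parallelogram identity minimizing sequences are Cauchy.\<close>

lemma riesz_representation:
  fixes f :: "'a :: {real_inner, complete_space} \<Rightarrow> real"
  assumes f: "bounded_linear f"
  shows "\<exists>u. \<forall>x. f x = inner u x"
proof -
  interpret f: bounded_linear f by (rule f)
  define J where "J = (\<lambda>x. (norm x)\<^sup>2 - 2 * f x)"
  obtain K where K: "\<And>x. norm (f x) \<le> norm x * K"
    using f.bounded by blast
  have lower: "- K\<^sup>2 \<le> J x" for x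
  proof -
    have "f x \<le> norm x * K"
      using K[of x] by simp
    then have "(norm x - K)\<^sup>2 \<le> J x + K\<^sup>2"
      by (simp add: J_def power2_diff)
    then show ?thesis
      using zero_le_power2[of "norm x - K"] by linarith
  qed
  then have bdd: "bdd_below (range J)"
    by (intro bdd_belowI[of _ "- K\<^sup>2"]) auto
  define m where "m = (INF x. J x)"
  have m_le: "m \<le> J x" for x
    unfolding m_def by (rule cINF_lower[OF bdd]) simp
  have "\<exists>x. J x < m + 1 / Suc n" for n
    using cINF_less_iff[OF _ bdd, of "m + 1 / Suc n"] by (auto simp: m_def)
  then obtain X where X: "\<And>n. J (X n) < m + 1 / Suc n"
    by metis
  have parallelogram: "(norm (x - y))\<^sup>2 = 2 * J x + 2 * J y - 4 * J ((1/2) *\<^sub>R (x + y))" for x y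
    by (simp add: J_def power2_norm_eq_inner f.scaleR f.add inner_add_left inner_add_right
        inner_diff_left inner_diff_right inner_commute field_simps)
  have dist_bound: "(norm (X i - X j))\<^sup>2 < 4 / Suc N" if "N \<le> i" "N \<le> j" for N i j
  proof -
    have "1 / Suc i \<le> 1 / Suc N" "1 / Suc j \<le> 1 / Suc N"
      using that by (simp_all add: frac_le)
    then show ?thesis
      using X[of i] X[of j] m_le[of "(1/2) *\<^sub>R (X i + X j)"] parallelogram[of "X i" "X j"]
      by (simp add: add_divide_distrib)
  qed
  have "Cauchy X"
  proof (rule CauchyI)
    fix e :: real assume e: "0 < e"
    obtain N :: nat where "4 / e\<^sup>2 < N"
      using reals_Archimedean2 by blast
    then have "4 / Suc N \<le> e\<^sup>2"
      using e by (simp add: field_simps) (smt (verit) zero_le_power2)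
    then have "norm (X i - X j) < e" if "N \<le> i" "N \<le> j" for i j
      using dist_bound[OF that] e by (intro power2_less_imp_less[of _ e]) linarith+
    then show "\<exists>M. \<forall>i\<ge>M. \<forall>j\<ge>M. norm (X i - X j) < e"
      by blast
  qed
  then obtain u where u: "X \<longlonglongrightarrow> u"
    using Cauchy_convergent_iff convergent_def by blast
  have "(\<lambda>n. J (X n)) \<longlonglongrightarrow> J u"
    unfolding J_def by (intro tendsto_intros u f.tendsto)
  moreover have "(\<lambda>n. m + 1 / Suc n) \<longlonglongrightarrow> m + 0"
    by (intro tendsto_intros LIMSEQ_Suc[OF lim_1_over_n])
  ultimately have "J u \<le> m + 0"
    by (rule LIMSEQ_le) (blast intro: less_imp_le[OF X])
  then have min: "J u \<le> J x" for x
    using m_le[of x] by linarith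
  have "f x = inner u x" for x
  proof (rule ccontr)
    assume ne: "f x \<noteq> inner u x"
    define d where "d = inner u x - f x"
    have expand: "J (u + t *\<^sub>R x) = J u + 2 * t * d + t\<^sup>2 * (norm x)\<^sup>2" for t
      unfolding J_def d_def
      by (simp add: power2_norm_eq_inner f.scaleR f.add inner_add_left inner_add_right
          inner_commute power2_eq_square[of t] algebra_simps)
    \<comment> \<open>A step of this length against the slope \<open>2 * d\<close> decreases \<open>J\<close>.\<close>
    define t where "t = - d / ((norm x)\<^sup>2 + 1)"
    have n: "(norm x)\<^sup>2 + 1 > 0"
      by (simp add: add_nonneg_pos)
    then have d: "d = - (t * ((norm x)\<^sup>2 + 1))"
      by (simp add: t_def)
    then have "t \<noteq> 0"
      using ne by (auto simp: d_def)
    then have "0 < t\<^sup>2 * ((norm x)\<^sup>2 + 2)"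
      by (intro mult_pos_pos) (auto simp: add_nonneg_pos)
    moreover have "0 \<le> 2 * t * d + t\<^sup>2 * (norm x)\<^sup>2"
      using min[of "u + t *\<^sub>R x"] expand[of t] by linarith
    moreover have "2 * t * d + t\<^sup>2 * (norm x)\<^sup>2 = - (t\<^sup>2 * ((norm x)\<^sup>2 + 2))"
      unfolding d by (simp add: power2_eq_square[of t] algebra_simps)
    ultimately show False by linarith
  qed
  then show ?thesis by blast
qed

lemma cinner_eqI:
  fixes y z :: "'a :: complex_hilbert"
  assumes "\<And>x. cinner x y = cinner x z"
  shows "y = z"
proof -
  have "inner (y - z) y = inner (y - z) z"
    by (simp add: inner_eq_Re_cinner assms)
  then have "inner (y - z) (y - z) = 0"
    by (simp add: inner_diff_right)
  then show ?thesis by simp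
qed

lemma scaleC_zero_left [simp]: "0 *\<^sub>C (x :: 'a :: complex_hilbert) = 0"
  by (metis scaleR_scaleC scaleR_zero_left of_real_0)

lemma scaleC_zero_right [simp]: "c *\<^sub>C (0 :: 'a :: complex_hilbert) = 0"
  using scaleC_add_right[of c 0 0] by simp

lemma cinner_zero_left [simp]: "cinner 0 (x :: 'a :: complex_hilbert) = 0"
  using cinner_scaleC_left[of 0 0 x] by simp

lemma cinner_zero_right [simp]: "cinner (x :: 'a :: complex_hilbert) 0 = 0"
  using cinner_scaleC_right[of x 0 0] by simp

lemma cinner_self_eq_0: "cinner x x = 0 \<longleftrightarrow> x = (0 :: 'a :: complex_hilbert)"
  by (simp add: cinner_self)

lemma bounded_clinearI:
  assumes "\<And>x y. T (x + y) = T x + T y" "\<And>c x. T (c *\<^sub>C x) = c *\<^sub>C T x"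
    "\<And>x. norm (T x) \<le> K * norm x"
  shows "bounded_clinear T"
  unfolding bounded_clinear_def
proof (intro conjI allI bounded_linear_intro)
  show "T (r *\<^sub>R x) = r *\<^sub>R T x" for r x
    using assms(2) by (simp add: scaleR_scaleC)
  show "norm (T x) \<le> norm x * K" for x
    using assms(3)[of x] by (simp add: mult.commute)
qed (use assms in auto)

lemma bounded_clinear_linear: "bounded_clinear T \<Longrightarrow> bounded_linear T"
  by (simp add: bounded_clinear_def)

lemma bounded_clinear_add: "bounded_clinear T \<Longrightarrow> T (x + y) = T x + T y"
  by (simp add: bounded_clinear_def bounded_linear.linear linear_add)

lemma bounded_clinear_diff: "bounded_clinear T \<Longrightarrow> T (x - y) = T x - T y"
  by (simp add: bounded_clinear_def bounded_linear.linear linear_diff)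

lemma bounded_clinear_scaleC: "bounded_clinear T \<Longrightarrow> T (c *\<^sub>C x) = c *\<^sub>C T x"
  by (simp add: bounded_clinear_def)

lemma bounded_clinear_bound:
  assumes "bounded_clinear T"
  obtains K where "K \<ge> 0" "\<And>x. norm (T x) \<le> K * norm x"
  using bounded_linear.nonneg_bounded[OF bounded_clinear_linear[OF assms]]
  by (auto simp: mult.commute)

lemma bounded_clinear_compose:
  assumes "bounded_clinear T" "bounded_clinear S"
  shows "bounded_clinear (T \<circ> S)"
  using bounded_linear_compose[of T S] assms by (auto simp: bounded_clinear_def o_def)

lemma bounded_clinear_id [simp]: "bounded_clinear id"
  by (rule bounded_clinearI[of _ 1]) auto

lemma adj_eqI:
  fixes T :: "'a :: complex_hilbert \<Rightarrow> 'b :: complex_hilbert"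
  assumes "\<And>x y. cinner (T x) y = cinner x (S y)"
  shows "adj T = S"
  unfolding adj_def
proof (rule the_equality)
  fix S' assume S': "\<forall>x y. cinner (T x) y = cinner x (S' y)"
  show "S' = S"
  proof
    fix y show "S' y = S y"
      by (rule cinner_eqI) (metis S' assms)
  qed
qed (use assms in blast)

lemma cinner_adj_right:
  assumes T: "bounded_clinear T"
  shows "cinner x (adj T y) = cinner (T x) y"
proof -
  have "\<exists>u. \<forall>x. inner y (T x) = inner u x" for y
    by (rule riesz_representation)
      (rule bounded_linear_compose[OF bounded_linear_inner_right bounded_clinear_linear[OF T]])
  then obtain S where S: "\<And>x y. inner y (T x) = inner (S y) x"
    by metis
  have "cinner (T x) y = cinner x (S y)" for x y
    using S[of y x] S[of y "\<i> *\<^sub>C x"]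
    by (simp add: cinner_eq_inner bounded_clinear_scaleC[OF T] inner_commute)
  then show ?thesis
    by (simp add: adj_eqI[of T S])
qed

lemma cinner_adj_left:
  assumes "bounded_clinear T"
  shows "cinner (adj T x) y = cinner x (T y)"
  by (metis assms cinner_adj_right cinner_commute)

lemma bounded_clinear_adj:
  assumes T: "bounded_clinear T"
  shows "bounded_clinear (adj T)"
proof -
  obtain K where K: "K \<ge> 0" "\<And>x. norm (T x) \<le> K * norm x"
    using bounded_clinear_bound[OF T] by blast
  show ?thesis
  proof (rule bounded_clinearI)
    show "adj T (x + y) = adj T x + adj T y" for x y
      by (rule cinner_eqI) (simp add: cinner_adj_right[OF T] cinner_add_right)
    show "adj T (c *\<^sub>C x) = c *\<^sub>C adj T x" for c x
      by (rule cinner_eqI) (simp add: cinner_adj_right[OF T] cinner_scaleC_right)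
    show "norm (adj T x) \<le> K * norm x" for x
    proof -
      have "norm (adj T x) * norm (adj T x) = inner (T (adj T x)) x"
        by (simp add: inner_eq_Re_cinner cinner_adj_right[OF T, symmetric]
            flip: power2_norm_eq_inner power2_eq_square)
          (simp add: cinner_self)
      also have "\<dots> \<le> norm (T (adj T x)) * norm x"
        by (rule norm_cauchy_schwarz)
      also have "\<dots> \<le> (K * norm (adj T x)) * norm x"
        by (intro mult_right_mono K) simp
      finally have "norm (adj T x) * norm (adj T x) \<le> norm (adj T x) * (K * norm x)"
        by (simp add: ac_simps)
      then show ?thesis
        using K(1) by (cases "norm (adj T x) = 0") (auto simp: mult_le_cancel_left)
    qed
  qed
qed

lemma adj_adj: "bounded_clinear T \<Longrightarrow> adj (adj T) = T"
  by (rule adj_eqI) (rule cinner_adj_left)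

lemma adj_compose:
  assumes "bounded_clinear T" "bounded_clinear S"
  shows "adj (T \<circ> S) = adj S \<circ> adj T"
  by (rule adj_eqI) (simp add: assms cinner_adj_right)

lemma unitary_adj_eqI:
  assumes "unitary U" "V \<circ> U = id"
  shows "adj U = V"
proof -
  have "V \<circ> (U \<circ> adj U) = adj U"
    by (simp add: assms(2) flip: comp_assoc)
  then show ?thesis
    using assms(1) by (simp add: unitary_def)
qed


section \<open>Commutants\<close>

lemma commutant_antimono: "\<S> \<subseteq> \<T> \<Longrightarrow> commutant \<T> \<subseteq> commutant \<S>"
  by (auto simp: commutant_def)

lemma subset_double_commutant:
  "(\<And>T. T \<in> \<S> \<Longrightarrow> bounded_clinear T) \<Longrightarrow> \<S> \<subseteq> commutant (commutant \<S>)"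
  by (auto simp: commutant_def)

lemma von_neumann_algebra_commutant:
  assumes bounded: "\<And>T. T \<in> \<S> \<Longrightarrow> bounded_clinear T" and adj: "\<And>T. T \<in> \<S> \<Longrightarrow> adj T \<in> \<S>"
  shows "von_neumann_algebra (commutant \<S>)"
  unfolding von_neumann_algebra_def
proof (intro conjI ballI)
  show "bounded_clinear T" if "T \<in> commutant \<S>" for T
    using that by (simp add: commutant_def)
  show "adj T \<in> commutant \<S>" if T: "T \<in> commutant \<S>" for T
  proof -
    have "adj T \<circ> X = X \<circ> adj T" if X: "X \<in> \<S>" for X
    proof -
      have "adj (adj X \<circ> T) = adj (T \<circ> adj X)"
        using T adj[OF X] by (simp add: commutant_def)
      then show ?thesis
        using T X by (simp add: commutant_def adj_compose adj_adj bounded bounded_clinear_adj)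
    qed
    then show ?thesis
      using T by (simp add: commutant_def bounded_clinear_adj)
  qed
  show "commutant (commutant (commutant \<S>)) = commutant \<S>"
  proof (intro equalityI)
    show "commutant (commutant (commutant \<S>)) \<subseteq> commutant \<S>"
      by (intro commutant_antimono subset_double_commutant bounded)
    show "commutant \<S> \<subseteq> commutant (commutant (commutant \<S>))"
      by (rule subset_double_commutant) (simp add: commutant_def)
  qed
qed

lemma generated_vna_superset: "\<S> \<subseteq> generated_vna \<S>"
  by (auto simp: generated_vna_def)

lemma generated_vna_least: "von_neumann_algebra \<N> \<Longrightarrow> \<S> \<subseteq> \<N> \<Longrightarrow> generated_vna \<S> \<subseteq> \<N>"
  by (auto simp: generated_vna_def)

section \<open>Operators on square-summable families\<close>

lemma coord_L: "coord (L g h) k = (if k = g then h else 0)"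
  by (simp add: L_def tensor.rep_eq chi.rep_eq)

lemma norm_L: "norm (L g h) = norm h"
proof -
  have "(norm (L g h))\<^sup>2 = (\<Sum>\<^sub>\<infinity>k\<in>{g}. (norm (coord (L g h) k))\<^sup>2)"
    unfolding norm_ell2_square by (rule infsum_cong_neutral) (auto simp: coord_L)
  then show ?thesis
    by (simp add: coord_L)
qed

lemma bounded_clinear_L: "bounded_clinear (L g)"
  by (rule bounded_clinearI[of _ 1])
    (auto intro!: ell2_eqI simp: coord_L norm_L)

lemma adj_L: "adj (L g) = (\<lambda>f. coord f g)"
proof (rule adj_eqI)
  fix h f
  have "cinner (L g h) f = (\<Sum>\<^sub>\<infinity>k\<in>{g}. cinner (coord (L g h) k) (coord f k))"
    unfolding cinner_ell2_def by (rule infsum_cong_neutral) (auto simp: coord_L)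
  then show "cinner (L g h) f = cinner h (coord f g)"
    by (simp add: coord_L)
qed

lemma bounded_clinear_coord: "bounded_clinear (\<lambda>f. coord f g)"
  by (rule bounded_clinearI[of _ 1]) (auto simp: norm_coord_le)

lemma coord_sum: "coord (sum v F) k = (\<Sum>g\<in>F. coord (v g) k)"
  by (induction F rule: infinite_finite_induct) auto

lemma has_sum_L_coord:
  fixes f :: "('g, 'h :: complex_hilbert) ell2"
  shows "((\<lambda>g. L g (coord f g)) has_sum f) UNIV"
proof -
  let ?s = "\<lambda>g. (norm (coord f g))\<^sup>2"
  have norm_diff: "(norm (sum (\<lambda>g. L g (coord f g)) F - f))\<^sup>2 = (norm f)\<^sup>2 - sum ?s F"
    if F: "finite F" for F
  proof -
    define u where "u = sum (\<lambda>g. L g (coord f g)) F"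
    have u: "coord u k = (if k \<in> F then coord f k else 0)" for k
      using F by (simp add: u_def coord_sum coord_L)
    have "inner u f = (norm u)\<^sup>2"
      unfolding power2_norm_eq_inner inner_ell2_def
      by (rule infsum_cong) (simp add: u)
    moreover have "(norm u)\<^sup>2 = (\<Sum>\<^sub>\<infinity>g\<in>F. ?s g)"
      unfolding norm_ell2_square by (rule infsum_cong_neutral) (auto simp: u)
    ultimately show ?thesis
      using F unfolding u_def[symmetric]
      by (simp add: power2_norm_eq_inner inner_diff_left inner_diff_right inner_commute)
  qed
  have "(sum ?s \<longlongrightarrow> (norm f)\<^sup>2) (finite_subsets_at_top UNIV)"
    using has_sum_infsum[OF coord_summable[of f]] by (simp add: has_sum_def norm_ell2_square)
  from tendsto_diff[OF tendsto_const this, of "(norm f)\<^sup>2"]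
  have "((\<lambda>F. (norm f)\<^sup>2 - sum ?s F) \<longlongrightarrow> 0) (finite_subsets_at_top UNIV)"
    by simp
  then have "((\<lambda>F. (norm (sum (\<lambda>g. L g (coord f g)) F - f))\<^sup>2) \<longlongrightarrow> 0)
      (finite_subsets_at_top UNIV)"
    by (rule Lim_transform_eventually)
      (auto simp: norm_diff intro!: eventually_finite_subsets_at_top_weakI)
  then have "((\<lambda>F. sqrt ((norm (sum (\<lambda>g. L g (coord f g)) F - f))\<^sup>2)) \<longlongrightarrow> sqrt 0)
      (finite_subsets_at_top UNIV)"
    by (rule tendsto_real_sqrt)
  then show ?thesis
    unfolding has_sum_def Lim_null[of _ f] by (simp add: tendsto_norm_zero_iff)
qed

lemma has_sum_bounded_clinear_L_coord:
  assumes "bounded_clinear T"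
  shows "((\<lambda>g. T (L g (coord f g))) has_sum T f) UNIV"
  using has_sum_bounded_linear[OF bounded_clinear_linear[OF assms] has_sum_L_coord[of f]]
  by (simp add: o_def)

lemma ell2_operator_eqI:
  assumes "bounded_clinear T" "bounded_clinear T'" "\<And>g h. T (L g h) = T' (L g h)"
  shows "T = T'"
proof
  fix f
  show "T f = T' f"
    using has_sum_bounded_clinear_L_coord[OF assms(1), of f]
      has_sum_bounded_clinear_L_coord[OF assms(2), of f]
    by (simp add: assms(3) has_sum_unique)
qed

text \<open>Composition with a permutation \<open>p\<close> of the index set. For other \<open>p\<close> the composed family
  need not be square-summable, and then the value is unspecified.\<close>

definition reindex ::
    "('g \<Rightarrow> 'g) \<Rightarrow> ('g, 'h :: complex_hilbert) ell2 \<Rightarrow> ('g, 'h) ell2" where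
  "reindex p f = Abs_ell2 (\<lambda>k. coord f (p k))"

lemma coord_reindex:
  assumes "bij p"
  shows "coord (reindex p f) k = coord f (p k)"
proof -
  have "(\<lambda>k. (norm (coord f (p k)))\<^sup>2) summable_on UNIV"
    using summable_on_reindex_bij_betw[OF assms, of "\<lambda>k. (norm (coord f k))\<^sup>2"] coord_summable
    by blast
  then show ?thesis
    by (simp add: reindex_def Abs_ell2_inverse)
qed

lemma norm_reindex:
  assumes "bij p"
  shows "norm (reindex p f) = norm f"
proof -
  have "(norm (reindex p f))\<^sup>2 = (norm f)\<^sup>2"
    unfolding norm_ell2_square coord_reindex[OF assms]
    by (rule infsum_reindex_bij_betw[OF assms])
  then show ?thesis
    by (simp add: power2_eq_iff_nonneg)
qed

lemma bounded_clinear_reindex: "bij p \<Longrightarrow> bounded_clinear (reindex p)"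
  by (rule bounded_clinearI[of _ 1]) (auto intro!: ell2_eqI simp: coord_reindex norm_reindex)

lemma adj_reindex:
  fixes p :: "'g \<Rightarrow> 'g"
  assumes p: "bij p" "bij q" "\<And>k. p (q k) = k"
  shows "adj (reindex p) = (reindex q :: ('g, 'h :: complex_hilbert) ell2 \<Rightarrow> _)"
proof (rule adj_eqI)
  fix f f' :: "('g, 'h) ell2"
  have q: "q (p k) = k" for k
    using p(3)[of "p k"] bij_is_inj[OF p(1)] by (simp add: inj_eq)
  show "cinner (reindex p f) f' = cinner f (reindex q f')"
    unfolding cinner_ell2_def coord_reindex[OF p(1)] coord_reindex[OF p(2)]
    using infsum_reindex_bij_betw[OF p(1), of "\<lambda>k. cinner (coord f k) (coord f' (q k))"]
    by (simp add: q)
qed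

lemma reindex_tensor: "bij p \<Longrightarrow> reindex p (\<xi> \<otimes>\<^sub>h h) = reindex p \<xi> \<otimes>\<^sub>h h"
  by (rule ell2_eqI) (simp add: coord_reindex tensor.rep_eq)

text \<open>The operator \<open>1 \<otimes> S\<close>, for bounded \<open>S\<close>.\<close>

definition amplify ::
    "('h :: complex_hilbert \<Rightarrow> 'h) \<Rightarrow> ('g, 'h) ell2 \<Rightarrow> ('g, 'h) ell2" where
  "amplify S f = Abs_ell2 (\<lambda>k. S (coord f k))"

lemma coord_amplify:
  assumes "bounded_clinear S"
  shows "coord (amplify S f) k = S (coord f k)"
proof -
  obtain K where "\<And>x. norm (S x) \<le> K * norm x"
    using bounded_clinear_bound[OF assms] by blast
  then have "(\<lambda>k. (norm (S (coord f k)))\<^sup>2) summable_on UNIV"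
    by (rule square_summable_bound[OF coord_summable])
  then show ?thesis
    by (simp add: amplify_def Abs_ell2_inverse)
qed

lemma bounded_clinear_amplify:
  fixes S :: "'h :: complex_hilbert \<Rightarrow> 'h"
  assumes S: "bounded_clinear S"
  shows "bounded_clinear (amplify S :: ('g, 'h) ell2 \<Rightarrow> _)"
proof -
  obtain K where K: "K \<ge> 0" "\<And>x. norm (S x) \<le> K * norm x"
    using bounded_clinear_bound[OF S] by blast
  show ?thesis
  proof (rule bounded_clinearI)
    show "amplify S (f + f') = amplify S f + amplify S f'" for f f' :: "('g, 'h) ell2"
      by (rule ell2_eqI) (simp add: coord_amplify[OF S] bounded_clinear_add[OF S])
    show "amplify S (c *\<^sub>C f) = c *\<^sub>C amplify S f" for c and f :: "('g, 'h) ell2"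
      by (rule ell2_eqI) (simp add: coord_amplify[OF S] bounded_clinear_scaleC[OF S])
    fix f :: "('g, 'h) ell2"
    have "(norm (amplify S f))\<^sup>2 \<le> (\<Sum>\<^sub>\<infinity>k. K\<^sup>2 * (norm (coord f k))\<^sup>2)"
      unfolding norm_ell2_square
    proof (rule infsum_mono)
      show "(norm (coord (amplify S f) k))\<^sup>2 \<le> K\<^sup>2 * (norm (coord f k))\<^sup>2" for k
        using power_mono[OF K(2)[of "coord f k"], of 2]
        by (simp add: coord_amplify[OF S] power_mult_distrib)
    qed (intro coord_summable summable_on_cmult_right)+
    also have "\<dots> = (K * norm f)\<^sup>2"
      by (simp add: infsum_cmult_right' norm_ell2_square power_mult_distrib)
    finally show "norm (amplify S f) \<le> K * norm f"
      by (rule power2_le_imp_le) (simp add: K)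
  qed
qed

lemma amplify_tensor: "bounded_clinear S \<Longrightarrow> amplify S (\<xi> \<otimes>\<^sub>h h) = \<xi> \<otimes>\<^sub>h S h"
  by (rule ell2_eqI) (simp add: coord_amplify tensor.rep_eq bounded_clinear_scaleC)


section \<open>The right von Neumann algebra as a commutant\<close>

text \<open>Left and right translation, on families with values in any Hilbert space: they map
  \<open>L k h\<close> to \<open>L (g + k) h\<close> and to \<open>L (k - g) h\<close>.\<close>

definition translate ::
    "'g :: group_add \<Rightarrow> ('g, 'h :: complex_hilbert) ell2 \<Rightarrow> ('g, 'h) ell2" where
  "translate g = reindex (\<lambda>k. - g + k)"

definition right_translate ::
    "'g :: group_add \<Rightarrow> ('g, 'h :: complex_hilbert) ell2 \<Rightarrow> ('g, 'h) ell2" where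
  "right_translate g = reindex (\<lambda>k. k + g)"

lemma coord_translate: "coord (translate g f) k = coord f (- g + k)"
  by (simp add: translate_def coord_reindex bij_plus)

lemma coord_right_translate: "coord (right_translate g f) k = coord f (k + g)"
  by (simp add: right_translate_def coord_reindex bij_plus_right)

lemma bounded_clinear_translate: "bounded_clinear (translate g)"
  by (simp add: translate_def bounded_clinear_reindex bij_plus)

lemma bounded_clinear_right_translate: "bounded_clinear (right_translate g)"
  by (simp add: right_translate_def bounded_clinear_reindex bij_plus_right)

lemma adj_translate: "adj (translate g) = translate (- g)"
  unfolding translate_def
  by (rule adj_reindex) (auto simp: bij_plus add.assoc[symmetric])

lemma translate_tensor: "translate g (\<xi> \<otimes>\<^sub>h h) = translate g \<xi> \<otimes>\<^sub>h h"
  by (simp add: translate_def reindex_tensor bij_plus)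

lemma right_translate_tensor: "right_translate g (\<xi> \<otimes>\<^sub>h h) = right_regular g \<xi> \<otimes>\<^sub>h h"
  by (simp add: right_translate_def reindex_tensor bij_plus_right)
    (simp add: reindex_def right_regular_def)

lemma translate_L: "translate g (L k h) = L (g + k) h"
proof (rule ell2_eqI)
  have "- g + j = k \<longleftrightarrow> j = g + k" for j
    by (auto simp flip: add.assoc)
  then show "coord (translate g (L k h)) j = coord (L (g + k) h) j" for j
    by (simp add: coord_translate coord_L)
qed

lemma right_translate_L: "right_translate g (L k h) = L (k - g) h"
  by (rule ell2_eqI) (auto simp: coord_right_translate coord_L eq_diff_eq)

lemma von_neumann_algebra_commutant_translate: "von_neumann_algebra (commutant (range translate))"
  by (rule von_neumann_algebra_commutant) (auto simp: bounded_clinear_translate adj_translate)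

lemma right_vna_commutes_translate:
  assumes "T \<in> right_vna"
  shows "T (translate g \<xi>) = translate g (T \<xi>)"
proof -
  have eq: "right_regular = (right_translate :: 'a \<Rightarrow> ('a, complex) ell2 \<Rightarrow> _)"
    by (simp add: fun_eq_iff right_regular_def right_translate_def reindex_def)
  have "right_translate k \<circ> translate j = translate j \<circ> right_translate k"
    for j k :: 'a
    by (auto intro!: ell2_eqI simp: fun_eq_iff coord_translate coord_right_translate add.assoc)
  then have "range right_regular \<subseteq> (commutant (range translate) :: (('a, complex) ell2 \<Rightarrow> _) set)"
    by (auto simp: eq commutant_def bounded_clinear_right_translate)
  then have "right_vna \<subseteq> (commutant (range translate) :: (('a, complex) ell2 \<Rightarrow> _) set)"
    unfolding right_vna_def by (intro generated_vna_least von_neumann_algebra_commutant_translate)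
  then have "T \<in> commutant (range translate)"
    using assms by (rule subsetD)
  then have "T \<circ> translate g = translate g \<circ> T"
    by (simp add: commutant_def)
  then show ?thesis
    by (simp add: fun_eq_iff)
qed

lemma right_regular_in_right_vna: "right_regular g \<in> right_vna"
  unfolding right_vna_def by (rule subsetD[OF generated_vna_superset]) simp

lemma id_in_right_vna: "(id :: ('g :: group_add, complex) ell2 \<Rightarrow> _) \<in> right_vna"
proof -
  have "right_regular (0 :: 'g) = id"
    by (simp add: fun_eq_iff right_regular_def coord_inverse)
  then show ?thesis
    using right_regular_in_right_vna[of "0 :: 'g"] by simp
qed

text \<open>The commutation theorem in the form needed here. An operator commuting with left
  translations has a matrix with entries \<open>m (- l + g)\<close> at \<open>(g, l)\<close>, and an operator commuting
  with right translations has entries \<open>y (g - l)\<close>. If moreover the latter commutes with all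
  \<open>1 \<otimes> S\<close>, then each \<open>y i\<close> commutes with each \<open>m j\<close>, and the two matrix products are
  rearrangements of one another.\<close>

lemma translate_commutant_commute:
  fixes M Y :: "('g :: group_add, 'h :: complex_hilbert) ell2 \<Rightarrow> ('g, 'h) ell2"
  assumes M: "bounded_clinear M" "\<And>g f. M (translate g f) = translate g (M f)"
    and Y: "bounded_clinear Y" "\<And>g f. Y (right_translate g f) = right_translate g (Y f)"
    and YS: "\<And>S f. bounded_clinear S \<Longrightarrow> Y (amplify S f) = amplify S (Y f)"
  shows "M \<circ> Y = Y \<circ> M"
proof (rule ell2_operator_eqI)
  show "bounded_clinear (M \<circ> Y)" "bounded_clinear (Y \<circ> M)"
    by (simp_all add: bounded_clinear_compose M Y)
  fix k :: 'g and h :: 'h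
  define m where "m = (\<lambda>j h. coord (M (L 0 h)) j)"
  define y where "y = (\<lambda>i h. coord (Y (L 0 h)) i)"
  have m: "coord (M (L l h)) g = m (- l + g) h" for g l h
    using M(2)[of l "L 0 h"] by (simp add: translate_L coord_translate m_def)
  have y: "coord (Y (L l h)) g = y (g - l) h" for g l h
    using Y(2)[of "- l" "L 0 h"] by (simp add: right_translate_L coord_right_translate y_def)
  have m_bounded: "bounded_clinear (m j)" for j
    using bounded_clinear_compose[OF bounded_clinear_coord
        bounded_clinear_compose[OF M(1) bounded_clinear_L]]
    by (simp add: m_def o_def)
  have commute: "y i (m j h) = m j (y i h)" for i j h
  proof -
    have "L (0 :: 'g) (m j h) = amplify (m j) (L 0 h)"
      unfolding L_def by (simp add: amplify_tensor m_bounded)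
    then have "y i (m j h) = coord (amplify (m j) (Y (L 0 h))) i"
      by (simp add: y_def YS m_bounded)
    then show ?thesis
      by (simp add: coord_amplify m_bounded y_def)
  qed
  have entry: "((\<lambda>l. coord (T (L l (coord f l))) g) has_sum coord (T f) g) UNIV"
    if "bounded_clinear T" for T :: "('g, 'h) ell2 \<Rightarrow> ('g, 'h) ell2" and f g
    using has_sum_bounded_clinear_L_coord[OF bounded_clinear_compose[OF bounded_clinear_coord that]]
    by (simp add: o_def)
  show "(M \<circ> Y) (L k h) = (Y \<circ> M) (L k h)"
  proof (rule ell2_eqI)
    fix g
    have MY: "((\<lambda>l. m (- l + g) (y (l - k) h)) has_sum coord (M (Y (L k h))) g) UNIV"
      using entry[OF M(1), of "Y (L k h)" g] by (simp add: m y)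
    have YM: "((\<lambda>l. y (g - l) (m (- k + l) h)) has_sum coord (Y (M (L k h))) g) UNIV"
      using entry[OF Y(1), of "M (L k h)" g] by (simp add: m y)
    \<comment> \<open>This substitution turns the entries \<open>(g, l)\<close> of \<open>Y\<close> and \<open>(l, k)\<close> of \<open>M\<close> into the entries
      \<open>(l, k)\<close> of \<open>Y\<close> and \<open>(g, l)\<close> of \<open>M\<close>.\<close>
    have b: "bij (\<lambda>l. k - l + g)"
      by (rule bij_betw_byWitness[where f' = "\<lambda>l. g - l + k"])
        (auto simp: diff_add_eq_diff_diff_swap)
    have "((\<lambda>l. y (g - (k - l + g)) (m (- k + (k - l + g)) h))
        has_sum coord (Y (M (L k h))) g) UNIV"
      using has_sum_reindex_bij_betw[OF b, of "\<lambda>l. y (g - l) (m (- k + l) h)"] YM by blast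
    moreover have "g - (k - l + g) = l - k" "- k + (k - l + g) = - l + g" for l
      by (simp_all add: diff_add_eq_diff_diff_swap add_diff_eq flip: add.assoc)
    ultimately have "((\<lambda>l. y (l - k) (m (- l + g) h)) has_sum coord (Y (M (L k h))) g) UNIV"
      by simp
    then show "coord ((M \<circ> Y) (L k h)) g = coord ((Y \<circ> M) (L k h)) g"
      using MY by (simp add: commute has_sum_unique)
  qed
qed

text \<open>The tensor product of the right von Neumann algebra with all bounded operators consists of
  the operators that commute with all left translations.\<close>

lemma RB_eq_commutant:
  "(RB :: (('g :: group_add, 'h :: complex_hilbert) ell2 \<Rightarrow> _) set) = commutant (range translate)"
proof
  let ?gen = "{X :: ('g, 'h) ell2 \<Rightarrow> _. bounded_clinear X \<and>
      (\<exists>T\<in>right_vna. \<exists>S\<in>{S. bounded_clinear S}. \<forall>\<xi> h. X (\<xi> \<otimes>\<^sub>h h) = T \<xi> \<otimes>\<^sub>h S h)}"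
  have RB: "RB = generated_vna ?gen"
    by (simp add: RB_def vna_tensor_def)
  have "X \<circ> translate g = translate g \<circ> X" if X: "X \<in> ?gen" for X g
  proof (rule ell2_operator_eqI)
    show "bounded_clinear (X \<circ> translate g)" "bounded_clinear (translate g \<circ> X)"
      using X by (auto intro!: bounded_clinear_compose bounded_clinear_translate)
    fix k h
    obtain T S where "T \<in> right_vna" and XTS: "\<And>\<xi> h. X (\<xi> \<otimes>\<^sub>h h) = T \<xi> \<otimes>\<^sub>h S h"
      using X by blast
    then show "(X \<circ> translate g) (L k h) = (translate g \<circ> X) (L k h)"
      by (simp add: L_def translate_tensor XTS right_vna_commutes_translate)
  qed
  then show "RB \<subseteq> (commutant (range translate) :: (('g, 'h) ell2 \<Rightarrow> _) set)"
    unfolding RB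
    by (intro generated_vna_least von_neumann_algebra_commutant_translate)
      (auto simp: commutant_def)
  show "(commutant (range translate) :: (('g, 'h) ell2 \<Rightarrow> _) set) \<subseteq> RB"
  proof
    fix M :: "('g, 'h) ell2 \<Rightarrow> ('g, 'h) ell2"
    assume "M \<in> commutant (range translate)"
    then have M: "bounded_clinear M" "\<And>g f. M (translate g f) = translate g (M f)"
      by (auto simp: commutant_def fun_eq_iff)
    show "M \<in> RB"
      unfolding RB generated_vna_def
    proof (intro InterI, clarify)
      fix \<N> assume N: "von_neumann_algebra \<N>" and gen: "?gen \<subseteq> \<N>"
      have mem: "X \<in> \<N>" if "bounded_clinear X" "T \<in> right_vna" "bounded_clinear S"
        "\<And>\<xi> h. X (\<xi> \<otimes>\<^sub>h h) = T \<xi> \<otimes>\<^sub>h S h" for X T S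
        by (rule subsetD[OF gen]) (use that in blast)
      have "right_translate g \<in> \<N>" for g
        by (rule mem[of _ "right_regular g" id])
          (simp_all add: bounded_clinear_right_translate right_regular_in_right_vna
            right_translate_tensor)
      moreover have "amplify S \<in> \<N>" if "bounded_clinear S" for S
        by (rule mem[of _ id S])
          (simp_all add: bounded_clinear_amplify id_in_right_vna amplify_tensor that)
      ultimately have "M \<circ> Y = Y \<circ> M" if "Y \<in> commutant \<N>" for Y
        using that by (intro translate_commutant_commute M) (auto simp: commutant_def fun_eq_iff)
      then have "M \<in> commutant (commutant \<N>)"
        using M(1) by (simp add: commutant_def)
      then show "M \<in> \<N>"
        using N by (simp add: von_neumann_algebra_def)
    qed
  qed
qed

lemma RB_iff: "M \<in> RB \<longleftrightarrow> bounded_clinear M \<and> (\<forall>g f. M (translate g f) = translate g (M f))"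
  by (auto simp: RB_eq_commutant commutant_def fun_eq_iff)

lemma RB_adj: "M \<in> RB \<Longrightarrow> adj M \<in> RB"
  using von_neumann_algebra_commutant_translate
  unfolding RB_eq_commutant von_neumann_algebra_def by blast

section \<open>Frame generators and their analysis operators\<close>

lemma unitary_representation_0:
  assumes "unitary_representation \<pi>"
  shows "\<pi> 0 = id"
proof -
  have u: "unitary (\<pi> 0)" and idem: "\<pi> 0 \<circ> \<pi> 0 = \<pi> 0"
    using assms unfolding unitary_representation_def by (metis add_0)+
  have "adj (\<pi> 0) \<circ> (\<pi> 0 \<circ> \<pi> 0) = \<pi> 0"
    using u by (simp add: unitary_def flip: comp_assoc)
  then show ?thesis
    using u by (simp add: idem unitary_def)
qed

lemma unitary_representation_add:
  "unitary_representation \<pi> \<Longrightarrow> \<pi> (g + k) x = \<pi> g (\<pi> k x)"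
  by (simp add: unitary_representation_def)

lemma unitary_representation_cancel:
  assumes "unitary_representation \<pi>"
  shows "\<pi> g (\<pi> (- g) x) = x" "\<pi> (- g) (\<pi> g x) = x"
  by (simp_all flip: unitary_representation_add[OF assms]
      add: unitary_representation_0[OF assms])

lemma unitary_representation_bounded:
  "unitary_representation \<pi> \<Longrightarrow> bounded_clinear (\<pi> g)"
  by (simp add: unitary_representation_def unitary_def)

lemma adj_unitary_representation:
  assumes "unitary_representation \<pi>"
  shows "adj (\<pi> (- g)) = \<pi> g"
  using assms unitary_representation_cancel(1)[OF assms, of g]
  by (intro unitary_adj_eqI) (auto simp: unitary_representation_def fun_eq_iff)

text \<open>The analysis operator, stated without infinite sums: a bounded operator whose components
  are the members of the orbit family of \<open>B\<close>.\<close>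

definition analyzes ::
    "('g :: group_add \<Rightarrow> 'a \<Rightarrow> 'a) \<Rightarrow> ('a :: complex_hilbert \<Rightarrow> 'h :: complex_hilbert) \<Rightarrow>
     ('a \<Rightarrow> ('g, 'h) ell2) \<Rightarrow> bool" where
  "analyzes \<pi> B \<theta> \<longleftrightarrow> bounded_clinear \<theta> \<and> (\<forall>g x. coord (\<theta> x) g = B (\<pi> (- g) x))"

lemma analyzes_eq_analysis:
  assumes "analyzes \<pi> B \<theta>"
  shows "\<theta> = analysis \<pi> B"
proof
  fix x
  have "((\<lambda>g. L g (B (\<pi> (- g) x))) has_sum \<theta> x) UNIV"
    using has_sum_L_coord[of "\<theta> x"] assms by (simp add: analyzes_def)
  then show "\<theta> x = analysis \<pi> B x"
    unfolding analysis_def by (rule infsumI[symmetric])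
qed

lemma analyzes_component:
  assumes "analyzes \<pi> B \<theta>"
  shows "adj (L g) \<circ> \<theta> = B \<circ> \<pi> (- g)"
  using assms by (simp add: analyzes_def adj_L fun_eq_iff)

lemma analyzes_bounded_generator:
  assumes "unitary_representation \<pi>" "analyzes \<pi> B \<theta>"
  shows "bounded_clinear B"
proof -
  have "B = adj (L 0) \<circ> \<theta>"
    by (simp add: analyzes_component[OF assms(2)] unitary_representation_0[OF assms(1)])
  then show ?thesis
    using assms(2) by (simp add: analyzes_def bounded_clinear_compose bounded_clinear_adj
        bounded_clinear_L)
qed

lemma analyzes_has_sum:
  assumes \<pi>: "unitary_representation \<pi>" and \<theta>: "analyzes \<pi> B \<theta>"
  shows "((\<lambda>g. adj (B \<circ> \<pi> (- g)) ((B \<circ> \<pi> (- g)) x)) has_sum adj \<theta> (\<theta> x)) UNIV"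
proof -
  have b: "bounded_clinear \<theta>"
    using \<theta> by (simp add: analyzes_def)
  have "adj (B \<circ> \<pi> (- g)) ((B \<circ> \<pi> (- g)) x) = adj \<theta> (L g (coord (\<theta> x) g))" for g
    unfolding analyzes_component[OF \<theta>, symmetric]
    by (simp add: adj_compose adj_adj bounded_clinear_adj bounded_clinear_L b) (simp add: adj_L)
  then show ?thesis
    using has_sum_bounded_clinear_L_coord[OF bounded_clinear_adj[OF b], of "\<theta> x"] by simp
qed

lemma frame_operator_eq:
  assumes \<pi>: "unitary_representation \<pi>" and \<theta>: "analyzes \<pi> B \<theta>"
  shows "frame_operator \<pi> B = adj \<theta> \<circ> \<theta>"
proof
  fix x
  have "adj (B \<circ> \<pi> (- g)) = \<pi> g \<circ> adj B" for g
    by (simp add: adj_compose analyzes_bounded_generator[OF \<pi> \<theta>]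
        unitary_representation_bounded[OF \<pi>] adj_unitary_representation[OF \<pi>])
  then show "frame_operator \<pi> B x = (adj \<theta> \<circ> \<theta>) x"
    using analyzes_has_sum[OF \<pi> \<theta>, of x]
    by (simp add: frame_operator_def infsumI)
qed

lemma analyzes_translate:
  assumes \<pi>: "unitary_representation \<pi>" and \<theta>: "analyzes \<pi> B \<theta>"
  shows "translate g (\<theta> x) = \<theta> (\<pi> g x)"
  using \<theta>
  by (intro ell2_eqI)
    (simp add: analyzes_def coord_translate minus_add flip: unitary_representation_add[OF \<pi>])

text \<open>Strong convergence of the frame operator is what makes the analysis operator exist: its
  value at \<open>x\<close> has squared norm \<open>inner x (S x)\<close>.\<close>

lemma analyzes_exists:
  assumes B: "\<And>g. bounded_clinear (B \<circ> \<pi> (- g))"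
    and S: "bounded_clinear S"
    and sum: "\<And>x. ((\<lambda>g. adj (B \<circ> \<pi> (- g)) ((B \<circ> \<pi> (- g)) x)) has_sum S x) UNIV"
  shows "\<exists>\<theta>. analyzes \<pi> B \<theta>"
proof -
  define \<theta> where "\<theta> x = Abs_ell2 (\<lambda>g. B (\<pi> (- g) x))" for x
  have norm_sum: "((\<lambda>g. (norm (B (\<pi> (- g) x)))\<^sup>2) has_sum inner x (S x)) UNIV" for x
  proof -
    have "inner x (adj (B \<circ> \<pi> (- g)) ((B \<circ> \<pi> (- g)) x)) = (norm (B (\<pi> (- g) x)))\<^sup>2" for g
      by (simp add: inner_eq_Re_cinner cinner_adj_right[OF B] cinner_self)
    then show ?thesis
      using has_sum_bounded_linear[OF bounded_linear_inner_right sum, of x x] by simp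
  qed
  have coord: "coord (\<theta> x) g = B (\<pi> (- g) x)" for x g
    using has_sum_imp_summable[OF norm_sum[of x]] by (simp add: \<theta>_def Abs_ell2_inverse)
  obtain K where K: "K \<ge> 0" "\<And>x. norm (S x) \<le> K * norm x"
    using bounded_clinear_bound[OF S] by blast
  have "bounded_clinear \<theta>"
  proof (rule bounded_clinearI)
    show "\<theta> (x + y) = \<theta> x + \<theta> y" for x y
      using bounded_clinear_add[OF B] by (intro ell2_eqI) (simp add: coord)
    show "\<theta> (c *\<^sub>C x) = c *\<^sub>C \<theta> x" for c x
      using bounded_clinear_scaleC[OF B] by (intro ell2_eqI) (simp add: coord)
    fix x
    have "(norm (\<theta> x))\<^sup>2 = inner x (S x)"
      using norm_sum[of x] by (simp add: norm_ell2_square coord infsumI)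
    also have "\<dots> \<le> norm x * norm (S x)"
      by (rule norm_cauchy_schwarz)
    also have "\<dots> \<le> norm x * (K * norm x)"
      by (intro mult_left_mono K) simp
    also have "\<dots> = (sqrt K * norm x)\<^sup>2"
      using K(1) by (simp add: power_mult_distrib) (simp add: power2_eq_square)
    finally show "norm (\<theta> x) \<le> sqrt K * norm x"
      by (rule power2_le_imp_le) (simp add: K)
  qed
  then show ?thesis
    using coord by (auto simp: analyzes_def)
qed

lemma bounded_op_on_UNIV: "bounded_op_on UNIV T \<longleftrightarrow> bounded_clinear T"
proof
  assume "bounded_op_on UNIV T"
  then show "bounded_clinear T"
    unfolding bounded_op_on_def by (auto intro: bounded_clinearI)
next
  assume T: "bounded_clinear T"
  obtain K where "\<And>x. norm (T x) \<le> K * norm x"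
    using bounded_clinear_bound[OF T] by blast
  then show "bounded_op_on UNIV T"
    unfolding bounded_op_on_def
    by (auto simp: bounded_clinear_add[OF T] bounded_clinear_scaleC[OF T])
qed

lemma invertible_on_UNIV:
  "invertible_on UNIV T \<longleftrightarrow> bounded_clinear T \<and> (\<exists>R. bounded_clinear R \<and> R \<circ> T = id \<and> T \<circ> R = id)"
  by (auto simp: invertible_on_def bounded_op_on_UNIV fun_eq_iff)

lemma frame_generator_iff:
  assumes \<pi>: "unitary_representation \<pi>"
  shows "frame_generator \<pi> B \<longleftrightarrow> (\<exists>\<theta>. analyzes \<pi> B \<theta> \<and> invertible_on UNIV (adj \<theta> \<circ> \<theta>))"
proof
  assume "frame_generator \<pi> B"
  then obtain S where B: "\<And>g. bounded_clinear (B \<circ> \<pi> (- g))"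
    and S: "bounded_clinear S" "invertible_on UNIV S"
    and sum: "\<And>x. ((\<lambda>g. adj (B \<circ> \<pi> (- g)) ((B \<circ> \<pi> (- g)) x)) has_sum S x) UNIV"
    unfolding frame_generator_def ov_frame_def positive_op_def by blast
  obtain \<theta> where \<theta>: "analyzes \<pi> B \<theta>"
    using analyzes_exists[of B \<pi>, OF B S(1) sum] by blast
  have "adj \<theta> \<circ> \<theta> = S"
    using has_sum_unique[OF analyzes_has_sum[OF \<pi> \<theta>] sum] by (simp add: fun_eq_iff)
  then show "\<exists>\<theta>. analyzes \<pi> B \<theta> \<and> invertible_on UNIV (adj \<theta> \<circ> \<theta>)"
    using \<theta> S(2) by blast
next
  assume "\<exists>\<theta>. analyzes \<pi> B \<theta> \<and> invertible_on UNIV (adj \<theta> \<circ> \<theta>)"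
  then obtain \<theta> where \<theta>: "analyzes \<pi> B \<theta>" and inv: "invertible_on UNIV (adj \<theta> \<circ> \<theta>)"
    by blast
  have b: "bounded_clinear \<theta>"
    using \<theta> by (simp add: analyzes_def)
  have "cinner x ((adj \<theta> \<circ> \<theta>) x) = complex_of_real ((norm (\<theta> x))\<^sup>2)" for x
    by (simp add: cinner_adj_right[OF b] cinner_self)
  then have "positive_op (adj \<theta> \<circ> \<theta>)"
    by (simp add: positive_op_def bounded_clinear_compose bounded_clinear_adj b)
  moreover have "bounded_clinear B"
    by (rule analyzes_bounded_generator[OF \<pi> \<theta>])
  ultimately show "frame_generator \<pi> B"
    using inv analyzes_has_sum[OF \<pi> \<theta>] unitary_representation_bounded[OF \<pi>]
    unfolding frame_generator_def ov_frame_def by (auto intro!: bounded_clinear_compose)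
qed

lemma parseval_frame_generator_iff:
  assumes \<pi>: "unitary_representation \<pi>"
  shows "parseval_frame_generator \<pi> B \<longleftrightarrow> (\<exists>\<theta>. analyzes \<pi> B \<theta> \<and> adj \<theta> \<circ> \<theta> = id)"
proof
  assume "parseval_frame_generator \<pi> B"
  then have B: "\<And>g. bounded_clinear (B \<circ> \<pi> (- g))"
    and sum: "\<And>x. ((\<lambda>g. adj (B \<circ> \<pi> (- g)) ((B \<circ> \<pi> (- g)) x)) has_sum id x) UNIV"
    unfolding parseval_frame_generator_def parseval_ov_frame_def by auto
  obtain \<theta> where \<theta>: "analyzes \<pi> B \<theta>"
    using analyzes_exists[of B \<pi>, OF B bounded_clinear_id sum] by blast
  then show "\<exists>\<theta>. analyzes \<pi> B \<theta> \<and> adj \<theta> \<circ> \<theta> = id"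
    using has_sum_unique[OF analyzes_has_sum[OF \<pi> \<theta>] sum] by (auto simp: fun_eq_iff)
next
  assume "\<exists>\<theta>. analyzes \<pi> B \<theta> \<and> adj \<theta> \<circ> \<theta> = id"
  then obtain \<theta> where \<theta>: "analyzes \<pi> B \<theta>" and id: "adj \<theta> \<circ> \<theta> = id"
    by blast
  have "bounded_clinear B"
    by (rule analyzes_bounded_generator[OF \<pi> \<theta>])
  moreover have "adj \<theta> (\<theta> x) = x" for x
    using id by (simp add: fun_eq_iff)
  ultimately show "parseval_frame_generator \<pi> B"
    using analyzes_has_sum[OF \<pi> \<theta>] unitary_representation_bounded[OF \<pi>]
    unfolding parseval_frame_generator_def parseval_ov_frame_def
    by (auto intro!: bounded_clinear_compose)
qed

section \<open>Parametrization by operators commuting with left translations\<close>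

text \<open>A frame generator \<open>A\<close> with its analysis operator \<open>\<theta>\<close> and the inverse \<open>T\<close> of its frame
  operator \<open>adj \<theta> \<circ> \<theta>\<close>.\<close>

locale frame_of_generator =
  fixes \<pi> :: "'g :: group_add \<Rightarrow> 'a :: complex_hilbert \<Rightarrow> 'a"
    and A :: "'a \<Rightarrow> 'h :: complex_hilbert"
    and \<theta> :: "'a \<Rightarrow> ('g, 'h) ell2" and T :: "'a \<Rightarrow> 'a"
  assumes rep: "unitary_representation \<pi>" and analyzes: "analyzes \<pi> A \<theta>"
    and T_bounded: "bounded_clinear T"
    and T_left: "\<And>x. T (adj \<theta> (\<theta> x)) = x" and T_right: "\<And>x. adj \<theta> (\<theta> (T x)) = x"
begin

lemma theta_bounded: "bounded_clinear \<theta>"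
  using analyzes by (simp add: analyzes_def)

text \<open>The frame projection, written through \<open>\<theta>\<close> and \<open>T\<close> only.\<close>

definition P :: "('g, 'h) ell2 \<Rightarrow> ('g, 'h) ell2" where
  "P f = \<theta> (T (adj \<theta> f))"

lemma P_bounded: "bounded_clinear P"
  using bounded_clinear_compose[OF theta_bounded
      bounded_clinear_compose[OF T_bounded bounded_clinear_adj[OF theta_bounded]]]
  by (simp add: P_def[abs_def] o_def)

lemma P_theta [simp]: "P (\<theta> x) = \<theta> x"
  by (simp add: P_def T_left)

lemma adj_theta_P: "adj \<theta> (P f) = adj \<theta> f"
  by (simp add: P_def T_right)

lemma range_P: "range P = range \<theta>"
proof
  show "range \<theta> \<subseteq> range P"
    by (metis P_theta image_subsetI rangeI)
qed (auto simp: P_def)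

lemma cinner_T: "cinner (T x) y = cinner x (T y)"
proof -
  have "cinner (T x) y = cinner (T x) (adj \<theta> (\<theta> (T y)))"
    by (simp add: T_right)
  also have "\<dots> = cinner (adj \<theta> (\<theta> (T x))) (T y)"
    by (simp add: cinner_adj_left cinner_adj_right theta_bounded)
  finally show ?thesis
    by (simp add: T_right)
qed

lemma adj_P: "adj P = P"
  by (rule adj_eqI) (simp add: P_def cinner_adj_left[symmetric] cinner_adj_right[symmetric]
      cinner_T theta_bounded)

lemma frame_projection_eq: "frame_projection \<pi> A = P"
proof -
  have "inv (adj \<theta> \<circ> \<theta>) = T"
    by (rule inv_unique_comp) (simp_all add: fun_eq_iff T_left T_right)
  then have "inv (frame_operator \<pi> A) = T"
    by (simp only: frame_operator_eq[OF rep analyzes])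
  then show ?thesis
    unfolding frame_projection_def analyzes_eq_analysis[OF analyzes, symmetric]
    by (simp add: P_def fun_eq_iff)
qed

lemma translate_theta: "translate g (\<theta> x) = \<theta> (\<pi> g x)"
  by (rule analyzes_translate[OF rep analyzes])

lemma adj_theta_translate: "adj \<theta> (translate g f) = \<pi> g (adj \<theta> f)"
proof (rule cinner_eqI)
  fix x
  have "cinner x (adj \<theta> (translate g f)) = cinner (adj (translate g) (\<theta> x)) f"
    by (simp add: cinner_adj_right theta_bounded cinner_adj_left bounded_clinear_translate)
  also have "\<dots> = cinner x (adj (\<pi> (- g)) (adj \<theta> f))"
    by (simp add: adj_translate translate_theta cinner_adj_right theta_bounded
        unitary_representation_bounded[OF rep])
  finally show "cinner x (adj \<theta> (translate g f)) = cinner x (\<pi> g (adj \<theta> f))"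
    by (simp add: adj_unitary_representation[OF rep])
qed

lemma T_commutes: "T (\<pi> g x) = \<pi> g (T x)"
proof -
  have "\<pi> g x = adj \<theta> (\<theta> (\<pi> g (T x)))"
    by (simp add: T_right adj_theta_translate flip: translate_theta)
  then show ?thesis
    by (simp add: T_left)
qed

lemma RB_imp_analyzes:
  assumes "M \<in> RB"
  shows "analyzes \<pi> (adj (L 0) \<circ> M \<circ> \<theta>) (M \<circ> \<theta>)"
proof -
  have M: "bounded_clinear M" "\<And>g f. M (translate g f) = translate g (M f)"
    using assms by (simp_all add: RB_iff)
  have "coord (M (\<theta> x)) g = coord (M (\<theta> (\<pi> (- g) x))) 0" for x g
    by (simp add: M(2) coord_translate flip: translate_theta)
  then show ?thesis
    by (simp add: analyzes_def adj_L bounded_clinear_compose M(1) theta_bounded)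
qed

text \<open>That \<open>M \<circ> \<theta>\<close> is an analysis operator only says that \<open>M\<close> commutes with left translations on
  the range of \<open>\<theta>\<close>. On the complement, which is invariant under them, \<open>M\<close> vanishes.\<close>

lemma RB_iff_analyzes:
  assumes M: "bounded_clinear M" "M = M \<circ> P"
  shows "M \<in> RB \<longleftrightarrow> analyzes \<pi> (adj (L 0) \<circ> M \<circ> \<theta>) (M \<circ> \<theta>)"
proof
  assume a: "analyzes \<pi> (adj (L 0) \<circ> M \<circ> \<theta>) (M \<circ> \<theta>)"
  have MP: "M (P f) = M f" for f
    using fun_cong[OF M(2), of f] by simp
  have "M (translate g f) = translate g (M f)" for g f
  proof -
    have "M (translate g f) = M (P (translate g f))"
      by (rule MP[symmetric])
    also have "\<dots> = M (\<theta> (\<pi> g (T (adj \<theta> f))))"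
      by (simp add: P_def adj_theta_translate T_commutes)
    also have "\<dots> = translate g (M (P f))"
      using analyzes_translate[OF rep a] by (simp add: P_def)
    finally show ?thesis
      by (simp add: MP)
  qed
  then show "M \<in> RB"
    using M(1) by (simp add: RB_iff)
qed (rule RB_imp_analyzes)

text \<open>The map \<open>\<theta>\<close> is a linear homeomorphism onto \<open>range P\<close> with inverse \<open>T \<circ> adj \<theta>\<close>, and \<open>adj \<theta>\<close> maps
  \<open>range P\<close> homeomorphically back with inverse \<open>\<theta> \<circ> T\<close>. So \<open>adj M \<circ> M\<close> on \<open>range P\<close> and its
  compression \<open>adj \<theta> \<circ> adj M \<circ> M \<circ> \<theta>\<close> are invertible together.\<close>

lemma invertible_on_range_P_iff:
  assumes M: "bounded_clinear M" "M = M \<circ> P"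
  shows "invertible_on (range P) (adj M \<circ> M)
    \<longleftrightarrow> invertible_on UNIV (adj (M \<circ> \<theta>) \<circ> (M \<circ> \<theta>))"
proof -
  define N where "N = adj M \<circ> M"
  have N: "bounded_clinear N"
    by (simp add: N_def bounded_clinear_compose bounded_clinear_adj M(1))
  have eq: "adj (M \<circ> \<theta>) \<circ> (M \<circ> \<theta>) = adj \<theta> \<circ> N \<circ> \<theta>"
    by (simp add: N_def adj_compose M(1) theta_bounded comp_assoc)
  have "adj M = adj (M \<circ> P)"
    using M(2) by (rule arg_cong)
  also have "\<dots> = P \<circ> adj M"
    by (simp add: adj_compose M(1) P_bounded adj_P)
  finally have PN: "P (N f) = N f" for f
    unfolding N_def by (metis comp_apply)
  have bounded: "bounded_clinear (adj \<theta> \<circ> N \<circ> \<theta>)"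
    by (simp add: bounded_clinear_compose bounded_clinear_adj theta_bounded N)
  have P_range: "P f = f" if "f \<in> range P" for f
    using that by (auto simp: range_P)
  show ?thesis
    unfolding eq N_def[symmetric]
  proof
    assume "invertible_on (range P) N"
    then obtain R where R: "bounded_op_on (range P) R"
      and inv: "\<And>f. f \<in> range P \<Longrightarrow> R (N f) = f" "\<And>f. f \<in> range P \<Longrightarrow> N (R f) = f"
      unfolding invertible_on_def by blast
    from R obtain C where R_range: "\<And>f. f \<in> range P \<Longrightarrow> R f \<in> range P"
      and R_add: "\<And>f f'. f \<in> range P \<Longrightarrow> f' \<in> range P \<Longrightarrow> R (f + f') = R f + R f'"
      and R_scaleC: "\<And>c f. f \<in> range P \<Longrightarrow> R (c *\<^sub>C f) = c *\<^sub>C R f"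
      and R_bound: "\<And>f. f \<in> range P \<Longrightarrow> norm (R f) \<le> C * norm f"
      unfolding bounded_op_on_def by blast
    have theta_range: "\<theta> x \<in> range P" for x
      by (simp add: range_P)
    obtain K where K: "\<And>x. norm (\<theta> x) \<le> K * norm x"
      using bounded_clinear_bound[OF theta_bounded] by blast
    \<comment> \<open>Nothing is known about \<open>R\<close> outside \<open>range P\<close>, so only its composition with \<open>\<theta>\<close> is a bounded
      operator.\<close>
    have R\<theta>: "bounded_clinear (R \<circ> \<theta>)"
    proof (rule bounded_clinearI)
      show "(R \<circ> \<theta>) (x + y) = (R \<circ> \<theta>) x + (R \<circ> \<theta>) y" for x y
        by (simp add: bounded_clinear_add[OF theta_bounded] R_add theta_range)
      show "(R \<circ> \<theta>) (c *\<^sub>C x) = c *\<^sub>C (R \<circ> \<theta>) x" for c x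
        by (simp add: bounded_clinear_scaleC[OF theta_bounded] R_scaleC theta_range)
      fix x
      have "norm (R (\<theta> x)) \<le> C * norm (\<theta> x)"
        by (rule R_bound[OF theta_range])
      also have "\<dots> \<le> \<bar>C\<bar> * norm (\<theta> x)"
        by (intro mult_right_mono) auto
      also have "\<dots> \<le> \<bar>C\<bar> * (K * norm x)"
        by (intro mult_left_mono K) auto
      finally show "norm ((R \<circ> \<theta>) x) \<le> (\<bar>C\<bar> * K) * norm x"
        by (simp add: mult.assoc)
    qed
    define Q where "Q = T \<circ> adj \<theta> \<circ> (R \<circ> \<theta>) \<circ> T"
    have "bounded_clinear Q"
      by (simp add: Q_def bounded_clinear_compose bounded_clinear_adj theta_bounded T_bounded R\<theta>)
    moreover have "Q (adj \<theta> (N (\<theta> x))) = x" for x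
    proof -
      have "Q (adj \<theta> (N (\<theta> x))) = T (adj \<theta> (R (P (N (\<theta> x)))))"
        by (simp add: Q_def P_def)
      then show ?thesis
        by (simp add: PN inv theta_range T_left)
    qed
    moreover have "adj \<theta> (N (\<theta> (Q x))) = x" for x
    proof -
      have "\<theta> (Q x) = R (\<theta> (T x))"
        using P_range[OF R_range[OF theta_range]] by (simp add: Q_def P_def)
      then show ?thesis
        by (simp add: inv theta_range T_right)
    qed
    ultimately show "invertible_on UNIV (adj \<theta> \<circ> N \<circ> \<theta>)"
      unfolding invertible_on_UNIV using bounded by (auto simp: fun_eq_iff intro!: exI[of _ Q])
  next
    assume "invertible_on UNIV (adj \<theta> \<circ> N \<circ> \<theta>)"
    then obtain Q where Q: "bounded_clinear Q" "\<And>x. Q (adj \<theta> (N (\<theta> x))) = x"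
        "\<And>x. adj \<theta> (N (\<theta> (Q x))) = x"
      by (auto simp: invertible_on_UNIV fun_eq_iff)
    define R where "R = \<theta> \<circ> Q \<circ> adj \<theta>"
    have R: "bounded_clinear R"
      by (simp add: R_def bounded_clinear_compose bounded_clinear_adj theta_bounded Q)
    have on_range: "bounded_op_on (range P) X"
      if "bounded_clinear X" "\<And>f. X f \<in> range P" for X
      using that bounded_op_on_UNIV[of X] unfolding bounded_op_on_def by blast
    have "N f \<in> range P" for f
      by (metis PN rangeI)
    moreover have "R f \<in> range P" for f
      by (simp add: R_def range_P)
    moreover have "R (N (\<theta> x)) = \<theta> x" for x
      by (simp add: R_def Q)
    moreover have "N (R (\<theta> x)) = \<theta> x" for x
    proof -
      have "N (R (\<theta> x)) = P (N (\<theta> (Q (adj \<theta> (\<theta> x)))))"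
        by (simp add: PN R_def)
      then show ?thesis
        by (simp add: P_def Q T_left)
    qed
    ultimately show "invertible_on (range P) N"
      unfolding invertible_on_def using on_range N R
      by (intro conjI exI[of _ R]) (auto simp: range_P)
  qed
qed

lemma frame_generator_of_RB:
  assumes "M \<in> RB" "M = M \<circ> P" "invertible_on (range P) (adj M \<circ> M)"
  shows "frame_generator \<pi> (adj (L 0) \<circ> M \<circ> \<theta>)"
proof -
  have "bounded_clinear M"
    using assms(1) by (simp add: RB_iff)
  then have "invertible_on UNIV (adj (M \<circ> \<theta>) \<circ> (M \<circ> \<theta>))"
    using assms(3) by (simp add: invertible_on_range_P_iff[OF _ assms(2)])
  with RB_imp_analyzes[OF assms(1)] show ?thesis
    unfolding frame_generator_iff[OF rep] by blast
qed

lemma generates_frame_iff: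
  assumes M: "bounded_clinear M" "M = M \<circ> P" "invertible_on (range P) (adj M \<circ> M)"
  shows "generates_frame \<pi> (adj (L 0) \<circ> M \<circ> \<theta>) (\<lambda>g. adj (L g) \<circ> M \<circ> \<theta>) \<longleftrightarrow> M \<in> RB"
proof
  assume "generates_frame \<pi> (adj (L 0) \<circ> M \<circ> \<theta>) (\<lambda>g. adj (L g) \<circ> M \<circ> \<theta>)"
  then have "adj (L g) ((M \<circ> \<theta>) x) = (adj (L 0) \<circ> M \<circ> \<theta>) (\<pi> (- g) x)" for g x
    by (simp add: generates_frame_def fun_eq_iff)
  then have "analyzes \<pi> (adj (L 0) \<circ> M \<circ> \<theta>) (M \<circ> \<theta>)"
    by (simp add: analyzes_def adj_L bounded_clinear_compose M(1) theta_bounded)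
  then show "M \<in> RB"
    by (simp add: RB_iff_analyzes[OF M(1,2)])
next
  assume RB: "M \<in> RB"
  have "adj (L g) \<circ> M \<circ> \<theta> = (adj (L 0) \<circ> M \<circ> \<theta>) \<circ> \<pi> (- g)" for g
    using analyzes_component[OF RB_imp_analyzes[OF RB], of g] by (simp only: comp_assoc)
  then show "generates_frame \<pi> (adj (L 0) \<circ> M \<circ> \<theta>) (\<lambda>g. adj (L g) \<circ> M \<circ> \<theta>)"
    using frame_generator_of_RB[OF RB M(2,3)] unfolding generates_frame_def by blast
qed

lemma RB_determined:
  assumes M: "M \<in> RB" "M = M \<circ> P"
  shows "M = analysis \<pi> (adj (L 0) \<circ> M \<circ> \<theta>) \<circ> T \<circ> adj \<theta>"
proof -
  have "M \<circ> P = (M \<circ> \<theta>) \<circ> T \<circ> adj \<theta>"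
    by (simp add: P_def fun_eq_iff)
  then show ?thesis
    unfolding analyzes_eq_analysis[OF RB_imp_analyzes[OF M(1)]]
    by (rule trans[OF M(2)])
qed

text \<open>Every analysis operator \<open>\<eta>\<close> for the same representation factors as \<open>M \<circ> \<theta>\<close> with \<open>M\<close> in \<open>RB\<close>;
  the invertibility of \<open>adj \<eta> \<circ> \<eta>\<close> plays no role here.\<close>

lemma RB_of_analyzes:
  fixes B :: "'a \<Rightarrow> 'h"
  assumes \<eta>: "analyzes \<pi> B \<eta>"
  defines "M \<equiv> \<eta> \<circ> T \<circ> adj \<theta>"
  shows "M \<in> RB" "M = M \<circ> P" "M \<circ> \<theta> = \<eta>" "adj (L 0) \<circ> M \<circ> \<theta> = B"
proof -
  have b: "bounded_clinear M"
    using \<eta> unfolding M_def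
    by (simp add: analyzes_def bounded_clinear_compose bounded_clinear_adj theta_bounded T_bounded)
  show MP: "M = M \<circ> P"
    by (simp add: M_def fun_eq_iff adj_theta_P)
  show M\<theta>: "M \<circ> \<theta> = \<eta>"
    by (simp add: M_def fun_eq_iff T_left)
  then show B: "adj (L 0) \<circ> M \<circ> \<theta> = B"
    using analyzes_component[OF \<eta>, of 0]
    by (simp add: comp_assoc unitary_representation_0[OF rep])
  show "M \<in> RB"
    using \<eta> unfolding RB_iff_analyzes[OF b MP] B M\<theta> .
qed

lemma frame_generators_eq:
  "{B. frame_generator \<pi> B} = {adj (L 0) \<circ> M \<circ> \<theta> | M.
    M \<in> RB \<and> M = M \<circ> P \<and> invertible_on (range P) (adj M \<circ> M)}"
proof (intro equalityI subsetI)
  fix B :: "'a \<Rightarrow> 'h" assume "B \<in> {B. frame_generator \<pi> B}"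
  then obtain \<eta> where \<eta>: "analyzes \<pi> B \<eta>" "invertible_on UNIV (adj \<eta> \<circ> \<eta>)"
    using frame_generator_iff[OF rep] by blast
  note M = RB_of_analyzes[OF \<eta>(1)]
  have "bounded_clinear (\<eta> \<circ> T \<circ> adj \<theta>)"
    using M(1) by (simp add: RB_iff)
  then have "invertible_on (range P) (adj (\<eta> \<circ> T \<circ> adj \<theta>) \<circ> (\<eta> \<circ> T \<circ> adj \<theta>))"
    using \<eta>(2) invertible_on_range_P_iff[OF _ M(2)] by (simp only: M(3))
  then show "B \<in> {adj (L 0) \<circ> M \<circ> \<theta> | M.
      M \<in> RB \<and> M = M \<circ> P \<and> invertible_on (range P) (adj M \<circ> M)}"
    by (intro CollectI exI[of _ "\<eta> \<circ> T \<circ> adj \<theta>"] conjI M(1,2) M(4)[symmetric])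
qed (use frame_generator_of_RB in blast)

text \<open>The condition \<open>adj V \<circ> V = P\<close> makes \<open>V\<close> a partial isometry with initial projection \<open>P\<close>, so
  it vanishes on the kernel of \<open>P\<close>.\<close>

lemma partial_isometry_absorbs_P:
  assumes V: "bounded_clinear V" "adj V \<circ> V = P"
  shows "V = V \<circ> P"
proof
  fix f
  have "P (f - P f) = 0"
    by (simp add: bounded_clinear_diff[OF P_bounded]) (simp add: P_def T_right)
  then have "cinner (V (f - P f)) (V (f - P f)) = 0"
    using fun_cong[OF V(2), of "f - P f"]
    by (simp flip: cinner_adj_right[OF V(1)])
  then show "V f = (V \<circ> P) f"
    by (simp add: cinner_self_eq_0 bounded_clinear_diff[OF V(1)])
qed

end

text \<open>A Parseval frame generator \<open>A\<close>: its frame operator, hence also \<open>T\<close>, is the identity.\<close>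

locale parseval_frame_of_generator = frame_of_generator \<pi> A \<theta> id
  for \<pi> :: "'g :: group_add \<Rightarrow> 'a :: complex_hilbert \<Rightarrow> 'a"
    and A :: "'a \<Rightarrow> 'h :: complex_hilbert" and \<theta> :: "'a \<Rightarrow> ('g, 'h) ell2"
begin

lemma adj_theta_theta: "adj \<theta> (\<theta> x) = x"
  using T_left by simp

lemma partial_isometry_compress:
  assumes V: "bounded_clinear V" "adj V \<circ> V = P"
  shows "adj (V \<circ> \<theta>) \<circ> (V \<circ> \<theta>) = id"
proof -
  have "adj V (V f) = P f" for f
    using V(2) by (simp add: fun_eq_iff)
  then show ?thesis
    by (simp add: adj_compose V(1) theta_bounded fun_eq_iff adj_theta_theta)
qed

lemma parseval_frame_generators_eq:
  "{B. parseval_frame_generator \<pi> B} = {adj (L 0) \<circ> V \<circ> \<theta> | V. V \<in> RB \<and> adj V \<circ> V = P}"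
proof (intro equalityI subsetI)
  fix B :: "'a \<Rightarrow> 'h" assume "B \<in> {B. parseval_frame_generator \<pi> B}"
  then obtain \<eta> where \<eta>: "analyzes \<pi> B \<eta>" "adj \<eta> \<circ> \<eta> = id"
    using parseval_frame_generator_iff[OF rep] by blast
  have b: "bounded_clinear \<eta>"
    using \<eta>(1) by (simp add: analyzes_def)
  have "adj (\<eta> \<circ> id \<circ> adj \<theta>) \<circ> (\<eta> \<circ> id \<circ> adj \<theta>) = \<theta> \<circ> (adj \<eta> \<circ> \<eta>) \<circ> adj \<theta>"
    by (simp add: adj_compose adj_adj bounded_clinear_adj theta_bounded b comp_assoc)
  also have "\<dots> = P"
    by (simp add: \<eta>(2) P_def fun_eq_iff)
  finally show "B \<in> {adj (L 0) \<circ> V \<circ> \<theta> | V. V \<in> RB \<and> adj V \<circ> V = P}"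
    using RB_of_analyzes[OF \<eta>(1)] by blast
next
  fix B :: "'a \<Rightarrow> 'h" assume "B \<in> {adj (L 0) \<circ> V \<circ> \<theta> | V. V \<in> RB \<and> adj V \<circ> V = P}"
  then obtain V where V: "V \<in> RB" "adj V \<circ> V = P" and B: "B = adj (L 0) \<circ> V \<circ> \<theta>"
    by blast
  have "bounded_clinear V"
    using V(1) by (simp add: RB_iff)
  then show "B \<in> {B. parseval_frame_generator \<pi> B}"
    using RB_imp_analyzes[OF V(1)] partial_isometry_compress[OF _ V(2)]
    by (auto simp: B parseval_frame_generator_iff[OF rep])
qed

lemma partial_isometry_determined:
  assumes V: "V \<in> RB" "adj V \<circ> V = P"
  shows "V = analysis \<pi> (adj (L 0) \<circ> V \<circ> \<theta>) \<circ> adj \<theta>"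
proof -
  have "bounded_clinear V"
    using V(1) by (simp add: RB_iff)
  from RB_determined[OF V(1) partial_isometry_absorbs_P[OF this V(2)]] show ?thesis
    by simp
qed

lemma frame_projection_partial_isometry:
  assumes V: "V \<in> RB" "adj V \<circ> V = P"
  shows "frame_projection \<pi> (adj (L 0) \<circ> V \<circ> \<theta>) = V \<circ> adj V"
proof -
  have b: "bounded_clinear V"
    using V(1) by (simp add: RB_iff)
  have a: "analyzes \<pi> (adj (L 0) \<circ> V \<circ> \<theta>) (V \<circ> \<theta>)"
    by (rule RB_imp_analyzes[OF V(1)])
  have "frame_projection \<pi> (adj (L 0) \<circ> V \<circ> \<theta>) = (V \<circ> \<theta>) \<circ> adj (V \<circ> \<theta>)"
    using analyzes_eq_analysis[OF a] partial_isometry_compress[OF b V(2)]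
    by (simp add: frame_projection_def frame_operator_eq[OF rep a])
  also have "\<dots> = (V \<circ> P) \<circ> adj V"
    by (simp add: adj_compose b theta_bounded P_def fun_eq_iff)
  also have "\<dots> = V \<circ> adj V"
    by (simp only: partial_isometry_absorbs_P[OF b V(2), symmetric])
  finally show ?thesis .
qed

end

theorem theorem7p1:
  fixes \<pi> :: "'g :: group_add \<Rightarrow> 'a :: complex_hilbert \<Rightarrow> 'a"
    and A :: "'a \<Rightarrow> 'h :: complex_hilbert"
  assumes "unitary_representation \<pi>"
    and "frame_generator \<pi> A"
  shows "let
      \<theta>\<^sub>A = (analysis \<pi> A :: 'a \<Rightarrow> ('g, 'h) ell2);
      P\<^sub>A = (frame_projection \<pi> A :: ('g, 'h) ell2 \<Rightarrow> ('g, 'h) ell2);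
      \<Phi> = (\<lambda>M :: ('g, 'h) ell2 \<Rightarrow> ('g, 'h) ell2. adj (L 0) \<circ> M \<circ> \<theta>\<^sub>A)
    in
      (\<forall>M. bounded_clinear M \<and> M = M \<circ> P\<^sub>A \<and> invertible_on (range P\<^sub>A) (adj M \<circ> M) \<longrightarrow>
        (generates_frame \<pi> (\<Phi> M) (\<lambda>g. adj (L g) \<circ> M \<circ> \<theta>\<^sub>A) \<longleftrightarrow> M \<in> RB)) \<and>
      (inj_on \<Phi> {M \<in> RB. M = M \<circ> P\<^sub>A \<and> invertible_on (range P\<^sub>A) (adj M \<circ> M)} \<and>
        {B. frame_generator \<pi> B} =
          {\<Phi> M | M. M \<in> RB \<and> M = M \<circ> P\<^sub>A \<and> invertible_on (range P\<^sub>A) (adj M \<circ> M)}) \<and>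
      (parseval_frame_generator \<pi> A \<longrightarrow>
        inj_on \<Phi> {V \<in> RB. adj V \<circ> V = P\<^sub>A} \<and>
        {B. parseval_frame_generator \<pi> B} = {\<Phi> V | V. V \<in> RB \<and> adj V \<circ> V = P\<^sub>A} \<and>
        (\<forall>V\<in>RB. adj V \<circ> V = P\<^sub>A \<longrightarrow> V = analysis \<pi> (\<Phi> V) \<circ> adj \<theta>\<^sub>A)) \<and>
      (parseval_frame_generator \<pi> A \<longrightarrow>
        (\<forall>P. projection P \<and> mvn_equivalent RB P P\<^sub>A \<longrightarrow>
          (\<exists>V\<in>RB. adj V \<circ> V = P\<^sub>A \<and> V \<circ> adj V = P) \<and>
          (\<forall>V\<in>RB. adj V \<circ> V = P\<^sub>A \<and> V \<circ> adj V = P \<longrightarrow>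
            P = frame_projection \<pi> (\<Phi> V))))"
proof -
  define \<theta> :: "'a \<Rightarrow> ('g, 'h) ell2" where "\<theta> = analysis \<pi> A"
  define P\<^sub>A :: "('g, 'h) ell2 \<Rightarrow> ('g, 'h) ell2" where "P\<^sub>A = frame_projection \<pi> A"
  define \<Phi> where "\<Phi> = (\<lambda>M :: ('g, 'h) ell2 \<Rightarrow> ('g, 'h) ell2. adj (L 0) \<circ> M \<circ> \<theta>)"
  obtain T where "frame_of_generator \<pi> A \<theta> T"
  proof -
    obtain \<eta> :: "'a \<Rightarrow> ('g, 'h) ell2"
      where \<eta>: "analyzes \<pi> A \<eta>" "invertible_on UNIV (adj \<eta> \<circ> \<eta>)"
      using assms frame_generator_iff by blast
    then have "\<eta> = \<theta>"
      by (simp add: \<theta>_def analyzes_eq_analysis)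
    then obtain T where "bounded_clinear T" "T \<circ> (adj \<theta> \<circ> \<theta>) = id" "(adj \<theta> \<circ> \<theta>) \<circ> T = id"
      using \<eta>(2) by (auto simp: invertible_on_UNIV)
    then have "frame_of_generator \<pi> A \<theta> T"
      using \<eta>(1) assms(1) \<open>\<eta> = \<theta>\<close> by unfold_locales (simp_all add: fun_eq_iff)
    then show thesis by (rule that)
  qed
  then interpret frame_of_generator \<pi> A \<theta> T .
  have P_eq: "P = P\<^sub>A"
    by (simp add: P\<^sub>A_def frame_projection_eq)
  have "\<forall>M. bounded_clinear M \<and> M = M \<circ> P\<^sub>A \<and> invertible_on (range P\<^sub>A) (adj M \<circ> M) \<longrightarrow>
      (generates_frame \<pi> (\<Phi> M) (\<lambda>g. adj (L g) \<circ> M \<circ> \<theta>) \<longleftrightarrow> M \<in> RB)"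
    using generates_frame_iff unfolding P_eq \<Phi>_def by blast
  moreover have "inj_on \<Phi> {M \<in> RB. M = M \<circ> P\<^sub>A \<and> invertible_on (range P\<^sub>A) (adj M \<circ> M)}"
  proof (rule inj_on_inverseI[where g = "\<lambda>B. analysis \<pi> B \<circ> T \<circ> adj \<theta>"])
    show "analysis \<pi> (\<Phi> M) \<circ> T \<circ> adj \<theta> = M"
      if "M \<in> {M \<in> RB. M = M \<circ> P\<^sub>A \<and> invertible_on (range P\<^sub>A) (adj M \<circ> M)}" for M
      using that RB_determined[of M, symmetric] unfolding P_eq \<Phi>_def by blast
  qed
  moreover have "{B. frame_generator \<pi> B} =
      {\<Phi> M | M. M \<in> RB \<and> M = M \<circ> P\<^sub>A \<and> invertible_on (range P\<^sub>A) (adj M \<circ> M)}"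
    using frame_generators_eq unfolding P_eq \<Phi>_def .
  moreover have "inj_on \<Phi> {V \<in> RB. adj V \<circ> V = P\<^sub>A} \<and>
      {B. parseval_frame_generator \<pi> B} = {\<Phi> V | V. V \<in> RB \<and> adj V \<circ> V = P\<^sub>A} \<and>
      (\<forall>V\<in>RB. adj V \<circ> V = P\<^sub>A \<longrightarrow> V = analysis \<pi> (\<Phi> V) \<circ> adj \<theta>) \<and>
      (\<forall>P. projection P \<and> mvn_equivalent RB P P\<^sub>A \<longrightarrow>
        (\<exists>V\<in>RB. adj V \<circ> V = P\<^sub>A \<and> V \<circ> adj V = P) \<and>
        (\<forall>V\<in>RB. adj V \<circ> V = P\<^sub>A \<and> V \<circ> adj V = P \<longrightarrow> P = frame_projection \<pi> (\<Phi> V)))"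
    if parseval: "parseval_frame_generator \<pi> A"
  proof -
    obtain \<eta> :: "'a \<Rightarrow> ('g, 'h) ell2" where \<eta>: "analyzes \<pi> A \<eta>" "adj \<eta> \<circ> \<eta> = id"
      using parseval parseval_frame_generator_iff[OF rep] by blast
    have "\<eta> = \<theta>"
      using \<eta>(1) by (simp add: \<theta>_def analyzes_eq_analysis)
    then have "adj \<theta> \<circ> \<theta> = id"
      using \<eta>(2) by simp
    then have id: "adj \<theta> (\<theta> x) = x" for x
      by (simp add: fun_eq_iff)
    interpret pf: parseval_frame_of_generator \<pi> A \<theta>
      by unfold_locales (simp_all add: id rep analyzes)
    have pf_P_eq: "pf.P = P\<^sub>A"
      by (simp add: P\<^sub>A_def pf.frame_projection_eq)
    have determined: "V = analysis \<pi> (\<Phi> V) \<circ> adj \<theta>" if "V \<in> RB" "adj V \<circ> V = P\<^sub>A" for V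
      using pf.partial_isometry_determined[of V] that unfolding pf_P_eq \<Phi>_def by blast
    have "inj_on \<Phi> {V \<in> RB. adj V \<circ> V = P\<^sub>A}"
      by (rule inj_on_inverseI[where g = "\<lambda>B. analysis \<pi> B \<circ> adj \<theta>"])
        (use determined[symmetric] in blast)
    moreover have "{B. parseval_frame_generator \<pi> B} = {\<Phi> V | V. V \<in> RB \<and> adj V \<circ> V = P\<^sub>A}"
      using pf.parseval_frame_generators_eq unfolding pf_P_eq \<Phi>_def .
    moreover have "\<exists>V\<in>RB. adj V \<circ> V = P\<^sub>A \<and> V \<circ> adj V = Q" if equiv: "mvn_equivalent RB Q P\<^sub>A" for Q
    proof -
      obtain V where V: "V \<in> RB" "adj V \<circ> V = Q" "V \<circ> adj V = P\<^sub>A"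
        using equiv unfolding mvn_equivalent_def by blast
      \<comment> \<open>Equivalence gives a partial isometry from \<open>Q\<close> to \<open>P\<^sub>A\<close>; its adjoint goes the other way.\<close>
      have "adj (adj V) = V"
        using V(1) by (simp add: RB_iff adj_adj)
      then show ?thesis
        using V by (intro bexI[of _ "adj V"] conjI RB_adj) simp_all
    qed
    moreover have "frame_projection \<pi> (\<Phi> V) = V \<circ> adj V" if "V \<in> RB" "adj V \<circ> V = P\<^sub>A" for V
      using pf.frame_projection_partial_isometry[of V] that unfolding pf_P_eq \<Phi>_def by blast
    ultimately show ?thesis
      by (intro conjI allI impI ballI determined) simp_all
  qed
  ultimately show ?thesis
    unfolding Let_def \<Phi>_def \<theta>_def P\<^sub>A_def by blast
qed

end
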